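(* Let $G$ be a connected graph on $n$ vertices, let $e=\{i,j\}$ be an edge of $G$, let $\widehat{a}_{e}\in\mathbb{R}$, and let $G_{e}^{w}$ be the dual number weighted graph in which $e$ has weight $1+\widehat{a}_e\varepsilon$ and all other edges have weight $1$. (a) Let $\tau$ be the number of spanning trees of $G$ and $\tau_e$ the number of spanning trees of $G$ containing $e$. Then $\Delta R_{ij}(G_{e}^{w})=-\widehat{a}_{e}(R_{ij}(G))^{2}=-\frac{\widehat{a}_{e}}{\tau^{2}}\tau_{e}^{2}$. (b) Let $\lambda_{1}\geq\cdots\geq\lambda_{n-1}\geq\lambda_{n}$ be the eigenvalues of the Laplacian matrix of $G$. If $\widehat{a}_{e}\neq 0$, then $\frac{1}{\lambda_{1}^{2}}\leq\frac{\Delta Kf(G_{e}^{w})}{-2n\widehat{a}_{e}}\leq\frac{1}{\lambda_{n-1}^{2}}$.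
   Context: Dual numbers: $\mathbb{D}=\{a_s+a_d\varepsilon: a_s,a_d\in\mathbb{R}\}$ with $\varepsilon\neq 0$, $\varepsilon^2=0$; $a_s$ is the standard part, $a_d$ the infinitesimal part. Edge weights are conductances, so edge $e$ of $G_e^w$ has resistance $1-\widehat{a}_e\varepsilon$ (a perturbation $-\widehat{a}_e$ of a unit resistor). The Laplacian matrix of a dual weighted graph is $L_w=D_w-A_w$ where $(A_w)_{st}$ is the weight of edge $\{s,t\}$ (0 if not an edge) and $D_w$ is diagonal with row sums of $A_w$. $R_{st}(G)$ is the effective resistance between $s,t$ with unit resistors on all edges of $G$; $R_{st}(G_e^w)$ is the effective resistance in $G_e^w$: $R_{ss}=0$, and for $s\ne t$, with net current $Y>0$ entering at $s$ and leaving at $t$, node potentials $v\in\mathbb{D}^n$ satisfy $L_wv=Y(\mathbf{1}_s-\mathbf{1}_t)$ and $R_{st}(G_e^w)=(v_s-v_t)/Y$. $Kf(G)=\sum_{s<t}R_{st}(G)$, $Kf(G_e^w)=\sum_{s<t}R_{st}(G_e^w)$. $\Delta R_{st}(G_e^w)$ is the infinitesimal part of $R_{st}(G_e^w)-R_{st}(G)$, and $\Delta Kf(G_e^w)$ is the infinitesimal part of $Kf(G_e^w)-Kf(G)$. *)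

theory Defs
  imports Complex_Main "Jordan_Normal_Form.Char_Poly"
begin

section \<open>Dual numbers\<close>

datatype dual_num = Dual (std_part: real) (inf_part: real)

lemma dual_num_eq_iff: "x = y \<longleftrightarrow> std_part x = std_part y \<and> inf_part x = inf_part y"
  by (cases x; cases y) simp

instantiation dual_num :: "{comm_ring_1, real_algebra_1}"
begin

definition zero_dual_num :: dual_num where "0 = Dual 0 0"
definition one_dual_num :: dual_num where "1 = Dual 1 0"
definition plus_dual_num :: "dual_num \<Rightarrow> dual_num \<Rightarrow> dual_num" where
  "x + y = Dual (std_part x + std_part y) (inf_part x + inf_part y)"
definition uminus_dual_num :: "dual_num \<Rightarrow> dual_num" where
  "- x = Dual (- std_part x) (- inf_part x)"
definition minus_dual_num :: "dual_num \<Rightarrow> dual_num \<Rightarrow> dual_num" where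
  "x - y = Dual (std_part x - std_part y) (inf_part x - inf_part y)"
definition times_dual_num :: "dual_num \<Rightarrow> dual_num \<Rightarrow> dual_num" where
  "x * y = Dual (std_part x * std_part y) (std_part x * inf_part y + inf_part x * std_part y)"
definition scaleR_dual_num :: "real \<Rightarrow> dual_num \<Rightarrow> dual_num" where
  "c *\<^sub>R x = Dual (c * std_part x) (c * inf_part x)"

instance
  by standard
    (simp_all add: zero_dual_num_def one_dual_num_def plus_dual_num_def uminus_dual_num_def
      minus_dual_num_def times_dual_num_def scaleR_dual_num_def dual_num_eq_iff algebra_simps)

end

definition dual_eps :: dual_num ("\<epsilon>") where "\<epsilon> = Dual 0 1"

lemma dual_eps_nonzero: "\<epsilon> \<noteq> 0"
  by (simp add: dual_eps_def zero_dual_num_def)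

lemma dual_eps_square: "\<epsilon> ^ 2 = 0"
  by (simp add: dual_eps_def zero_dual_num_def times_dual_num_def power2_eq_square)

lemma Dual_eq: "Dual a b = of_real a + of_real b * \<epsilon>"
  by (simp add: dual_eps_def of_real_def plus_dual_num_def times_dual_num_def
      scaleR_dual_num_def one_dual_num_def)


section \<open>Graphs and spanning trees\<close>

text \<open>A simple graph on \<open>n\<close> vertices has vertex set \<open>{0..<n}\<close>, so that vertices index the rows and
  columns of its matrices, and is given by its set of edges, which are two-element sets of
  vertices.\<close>

definition simple_graph :: "nat \<Rightarrow> nat set set \<Rightarrow> bool" where
  "simple_graph n E \<longleftrightarrow> (\<forall>e\<in>E. e \<subseteq> {0..<n} \<and> card e = 2)"

definition connected_graph :: "nat \<Rightarrow> nat set set \<Rightarrow> bool" where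
  "connected_graph n E \<longleftrightarrow> (\<forall>s<n. \<forall>t<n. (s, t) \<in> {(u, v). {u, v} \<in> E}\<^sup>*)"

text \<open>A cycle is given by its distinct vertices in cyclic order; \<open>3 \<le> length p\<close> rules out
  running back and forth along a single edge.\<close>

definition is_cycle :: "nat set set \<Rightarrow> nat list \<Rightarrow> bool" where
  "is_cycle E p \<longleftrightarrow> 3 \<le> length p \<and> distinct p \<and>
     (\<forall>k<length p. {p ! k, p ! (Suc k mod length p)} \<in> E)"

definition spanning_trees :: "nat \<Rightarrow> nat set set \<Rightarrow> nat set set set" where
  "spanning_trees n E = {T. T \<subseteq> E \<and> connected_graph n T \<and> (\<nexists>p. is_cycle T p)}"

definition num_spanning_trees :: "nat \<Rightarrow> nat set set \<Rightarrow> nat" where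
  "num_spanning_trees n E = card (spanning_trees n E)"

definition num_spanning_trees_containing :: "nat \<Rightarrow> nat set set \<Rightarrow> nat set \<Rightarrow> nat" where
  "num_spanning_trees_containing n E e = card {T \<in> spanning_trees n E. e \<in> T}"


section \<open>Weighted graphs and effective resistance\<close>

text \<open>The weights are taken from a commutative real algebra, so that the same definitions serve
  for real and for dual number weights. Weights are conductances.\<close>

definition adjacency_matrix :: "nat \<Rightarrow> nat set set \<Rightarrow> (nat set \<Rightarrow> 'a) \<Rightarrow> 'a::comm_ring_1 mat" where
  "adjacency_matrix n E w = mat n n (\<lambda>(s, t). if {s, t} \<in> E then w {s, t} else 0)"

definition degree_matrix :: "nat \<Rightarrow> nat set set \<Rightarrow> (nat set \<Rightarrow> 'a) \<Rightarrow> 'a::comm_ring_1 mat" where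
  "degree_matrix n E w =
     mat n n (\<lambda>(s, t). if s = t then \<Sum>u<n. adjacency_matrix n E w $$ (s, u) else 0)"

definition laplacian :: "nat \<Rightarrow> nat set set \<Rightarrow> (nat set \<Rightarrow> 'a) \<Rightarrow> 'a::comm_ring_1 mat" where
  "laplacian n E w = degree_matrix n E w - adjacency_matrix n E w"

text \<open>The value for \<open>s \<noteq> t\<close> is meaningful only where it depends neither on the current \<open>Y\<close> nor on
  the choice of the potential \<open>v\<close>, as in a connected graph whose weights have positive standard
  part.\<close>

definition eff_resistance ::
    "nat \<Rightarrow> nat set set \<Rightarrow> (nat set \<Rightarrow> 'a) \<Rightarrow> nat \<Rightarrow> nat \<Rightarrow> 'a::{comm_ring_1, real_algebra_1}" where
  "eff_resistance n E w s t =
     (if s = t then 0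
      else THE r. \<exists>Y::real. \<exists>v\<in>carrier_vec n. Y > 0 \<and>
        laplacian n E w *\<^sub>v v = of_real Y \<cdot>\<^sub>v (unit_vec n s - unit_vec n t) \<and>
        r = (v $ s - v $ t) /\<^sub>R Y)"

definition kirchhoff_index ::
    "nat \<Rightarrow> nat set set \<Rightarrow> (nat set \<Rightarrow> 'a) \<Rightarrow> 'a::{comm_ring_1, real_algebra_1}" where
  "kirchhoff_index n E w = (\<Sum>(s, t) \<in> {(s, t). s < t \<and> t < n}. eff_resistance n E w s t)"

definition unit_weight :: "nat set \<Rightarrow> real" where
  "unit_weight f = 1"

definition perturbed_weight :: "nat set \<Rightarrow> real \<Rightarrow> nat set \<Rightarrow> dual_num" where
  "perturbed_weight e a f = (if f = e then 1 + of_real a * \<epsilon> else 1)"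

definition Delta_resistance :: "nat \<Rightarrow> nat set set \<Rightarrow> nat set \<Rightarrow> real \<Rightarrow> nat \<Rightarrow> nat \<Rightarrow> real" where
  "Delta_resistance n E e a s t =
     inf_part (eff_resistance n E (perturbed_weight e a) s t
               - of_real (eff_resistance n E unit_weight s t))"

definition Delta_kirchhoff :: "nat \<Rightarrow> nat set set \<Rightarrow> nat set \<Rightarrow> real \<Rightarrow> real" where
  "Delta_kirchhoff n E e a =
     inf_part (kirchhoff_index n E (perturbed_weight e a)
               - of_real (kirchhoff_index n E unit_weight))"


section \<open>Laplacian eigenvalues\<close>

text \<open>\<open>laplacian_eigenvalue n E k\<close> is the \<open>k\<close>-th largest eigenvalue, where \<open>1 \<le> k \<le> n\<close> and
  eigenvalues are counted with multiplicity as roots of the characteristic polynomial. The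
  Laplacian is a real symmetric matrix, hence all \<open>n\<close> roots are real.\<close>

definition laplacian_eigenvalue :: "nat \<Rightarrow> nat set set \<Rightarrow> nat \<Rightarrow> real" where
  "laplacian_eigenvalue n E k =
     rev (sorted_list_of_multiset (proots (char_poly (laplacian n E unit_weight)))) ! (k - 1)"

end

theory Submission
  imports Defs
begin

text \<open>
  Kirchhoff's combinatorial potential: the number of spanning forests with two components, one
  containing \<open>s\<close> and \<open>x\<close> and the other containing \<open>t\<close>, is a potential at \<open>x\<close> for a current of
  \<open>\<tau>\<close> from \<open>s\<close> to \<open>t\<close>. Its drop along an edge counts, with sign, the spanning trees whose path
  from \<open>s\<close> to \<open>t\<close> uses that edge, so every spanning tree contributes a unit flow. For an edge
  \<open>{s, t}\<close> the total drop is \<open>\<tau>\<^sub>e\<close>, whence \<open>R = \<tau>\<^sub>e / \<tau>\<close>.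

  Let \<open>u\<close> be the mean-zero solution of \<open>L u = 1\<^sub>i - 1\<^sub>j\<close>. Expanding to first order in \<open>\<epsilon>\<close> and
  using the symmetry of \<open>L\<close> gives \<open>\<Delta>R\<^sub>s\<^sub>t = - a (u\<^sub>s - u\<^sub>t)\<^sup>2\<close>, and summing over pairs gives
  \<open>\<Delta>Kf = - a n |u|\<^sup>2\<close>. Since \<open>|L u|\<^sup>2 = 2\<close> and \<open>u\<close> is orthogonal to the kernel of \<open>L\<close>, the
  spectral theorem bounds \<open>|u|\<^sup>2 / 2\<close> by the inverse squares of the extreme nonzero eigenvalues.
\<close>

section \<open>Forests and spanning trees\<close>

definition reach :: "'a set set \<Rightarrow> ('a \<times> 'a) set" where
  "reach F = {(u, v). {u, v} \<in> F}\<^sup>*"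

lemma reach_refl [simp]: "(x, x) \<in> reach F"
  by (simp add: reach_def)

lemma reach_sym: "(x, y) \<in> reach F \<Longrightarrow> (y, x) \<in> reach F"
proof -
  have "sym {(u, v). {u, v} \<in> F}"
    by (auto simp: sym_def insert_commute)
  then show "(x, y) \<in> reach F \<Longrightarrow> (y, x) \<in> reach F"
    unfolding reach_def by (meson sym_rtrancl symD)
qed

lemma reach_trans: "(x, y) \<in> reach F \<Longrightarrow> (y, z) \<in> reach F \<Longrightarrow> (x, z) \<in> reach F"
  unfolding reach_def by (rule rtrancl_trans)

lemma reach_edge: "{x, y} \<in> F \<Longrightarrow> (x, y) \<in> reach F"
  unfolding reach_def by auto

lemma reach_mono: "F \<subseteq> G \<Longrightarrow> (x, y) \<in> reach F \<Longrightarrow> (x, y) \<in> reach G"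
  unfolding reach_def by (erule rtrancl_mono[THEN subsetD, rotated]) auto

text \<open>A walk can be shortened to cross the new edge at most once; the last two cases are the
  two directions of that crossing. With \<open>F\<close> as an edge set minus one edge, this also
  describes the effect of a deletion.\<close>

lemma reach_insert:
  "(u, v) \<in> reach (insert {x, y} F) \<longleftrightarrow>
     (u, v) \<in> reach F \<or> (u, x) \<in> reach F \<and> (y, v) \<in> reach F \<or> (u, y) \<in> reach F \<and> (x, v) \<in> reach F"
  (is "?L \<longleftrightarrow> ?R v")
proof
  assume ?L
  then show "?R v"
    unfolding reach_def[of "insert {x, y} F"]
  proof (induction rule: rtrancl_induct)
    case (step v w)
    then consider "{v, w} \<in> F" | "v = x" "w = y" | "v = y" "w = x"
      by (auto simp: doubleton_eq_iff)
    then show ?case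
    proof cases
      case 1
      then show ?thesis using step.IH reach_trans[OF _ reach_edge] by metis
    next
      case 2
      then show ?thesis using step.IH reach_sym reach_refl reach_trans by metis
    next
      case 3
      then show ?thesis using step.IH reach_sym reach_refl reach_trans by metis
    qed
  qed simp
next
  have sub: "(p, q) \<in> reach F \<Longrightarrow> (p, q) \<in> reach (insert {x, y} F)" for p q
    by (rule reach_mono) auto
  have xy: "(x, y) \<in> reach (insert {x, y} F)"
    by (simp add: reach_edge)
  assume "?R v"
  then show ?L
    by (meson sub xy reach_sym reach_trans)
qed

lemma connected_graph_reach: "connected_graph n E \<longleftrightarrow> (\<forall>s<n. \<forall>t<n. (s, t) \<in> reach E)"
  by (simp add: connected_graph_def reach_def)

text \<open>Acyclicity in the form "every edge is a bridge", which adapts to inserting and deleting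
  edges more easily than cycle lists. Since \<open>reach\<close> is reflexive, singleton edges are
  ruled out as well.\<close>

definition forest :: "'a set set \<Rightarrow> bool" where
  "forest F \<longleftrightarrow> (\<forall>x y. {x, y} \<in> F \<longrightarrow> (x, y) \<notin> reach (F - {{x, y}}))"

lemma forestD: "forest F \<Longrightarrow> {x, y} \<in> F \<Longrightarrow> (x, y) \<notin> reach (F - {{x, y}})"
  by (simp add: forest_def)

lemma forest_subset: "forest G \<Longrightarrow> F \<subseteq> G \<Longrightarrow> forest F"
  unfolding forest_def by (metis Diff_mono order_refl reach_mono subsetD)

text \<open>If an old edge \<open>{u, v}\<close> ceased to be a bridge, the detour around it would
  have to cross \<open>{x, y}\<close>. Closing the rest of the detour with \<open>{u, v}\<close>
  would then join \<open>x\<close> and \<open>y\<close> inside \<open>F\<close>.\<close>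

lemma forest_insert:
  assumes "forest F" and xy: "(x, y) \<notin> reach F"
  shows "forest (insert {x, y} F)"
  unfolding forest_def
proof (intro allI impI)
  fix u v
  assume uv: "{u, v} \<in> insert {x, y} F"
  show "(u, v) \<notin> reach (insert {x, y} F - {{u, v}})"
  proof (cases "{u, v} = {x, y}")
    case True
    then have "(u, v) \<notin> reach F"
      using xy by (auto simp: doubleton_eq_iff dest: reach_sym)
    then show ?thesis
      using True reach_mono[of "insert {x, y} F - {{u, v}}" F] by auto
  next
    case False
    then have uvF: "{u, v} \<in> F" using uv by auto
    let ?H = "F - {{u, v}}"
    have eq: "insert {x, y} F - {{u, v}} = insert {x, y} ?H"
      using False by auto
    have H: "(p, q) \<in> reach ?H \<Longrightarrow> (p, q) \<in> reach F" for p q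
      by (rule reach_mono) auto
    have "(u, v) \<notin> reach ?H"
      using forestD[OF \<open>forest F\<close> uvF] .
    moreover have "(u, v) \<in> reach F" using uvF by (rule reach_edge)
    ultimately show ?thesis
      unfolding eq reach_insert using xy by (meson H reach_sym reach_trans)
  qed
qed

lemma reach_imp_path:
  assumes "(x, y) \<in> reach F"
  shows "\<exists>p. p \<noteq> [] \<and> hd p = x \<and> last p = y \<and> distinct p \<and> successively (\<lambda>u v. {u, v} \<in> F) p"
  using assms unfolding reach_def
proof (induction rule: rtrancl_induct)
  case base
  show ?case by (rule exI[of _ "[x]"]) auto
next
  case (step y z)
  then obtain p where p: "p \<noteq> []" "hd p = x" "last p = y" "distinct p"
      "successively (\<lambda>u v. {u, v} \<in> F) p"
    by blast
  show ?case
  proof (cases "z \<in> set p")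
    case True
    \<comment> \<open>The vertex \<open>z\<close> was visited before: cutting the path back to that
      visit keeps its vertices distinct.\<close>
    then obtain q r where q: "p = q @ z # r" by (meson split_list)
    show ?thesis
      using p unfolding q
      by (intro exI[of _ "q @ [z]"]) (auto simp: successively_append_iff hd_append split: if_splits)
  next
    case False
    then show ?thesis
      using p step.hyps
      by (intro exI[of _ "p @ [z]"]) (auto simp: successively_append_iff)
  qed
qed

text \<open>A detour around an edge closes up with it to a cycle; conversely a cycle without its
  first edge is a detour around that edge.\<close>

lemma acyclic_iff_forest:
  assumes loopfree: "\<And>x. {x} \<notin> T"
  shows "(\<nexists>p. is_cycle T p) \<longleftrightarrow> forest T"
proof
  assume acyclic: "\<nexists>p. is_cycle T p"
  show "forest T"
    unfolding forest_def
  proof (intro allI impI notI)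
    fix x y
    assume xy: "{x, y} \<in> T" and "(x, y) \<in> reach (T - {{x, y}})"
    then obtain p where p: "p \<noteq> []" "hd p = x" "last p = y" "distinct p"
        "successively (\<lambda>u v. {u, v} \<in> T - {{x, y}}) p"
      using reach_imp_path by metis
    have "x \<noteq> y" using xy loopfree by auto
    have hd: "p ! 0 = x" using p by (simp add: hd_conv_nth)
    have la: "p ! (length p - 1) = y" using p by (simp add: last_conv_nth)
    have step: "{p ! k, p ! Suc k} \<in> T - {{x, y}}" if "Suc k < length p" for k
      using p(5) that by (simp add: successively_conv_nth)
    \<comment> \<open>A single vertex would give \<open>x = y\<close>, and two vertices would use
      the removed edge \<open>{x, y}\<close>.\<close>
    have len: "3 \<le> length p"
    proof (rule ccontr)
      assume "\<not> 3 \<le> length p"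
      moreover have "length p \<noteq> 0" using p(1) by simp
      ultimately have "length p = 1 \<or> length p = 2" by arith
      then show False
        using hd la step[of 0] \<open>x \<noteq> y\<close> by auto
    qed
    have "is_cycle T p"
      unfolding is_cycle_def
    proof (intro conjI allI impI)
      fix k assume "k < length p"
      show "{p ! k, p ! (Suc k mod length p)} \<in> T"
      proof (cases "Suc k < length p")
        case True
        then show ?thesis using step[of k] by simp
      next
        case False
        then have "Suc k = length p" "k = length p - 1"
          using \<open>k < length p\<close> by auto
        then show ?thesis using hd la xy by (simp add: insert_commute)
      qed
    qed (use len p in auto)
    then show False using acyclic by blast
  qed
next
  assume forest: "forest T"
  show "\<nexists>p. is_cycle T p"
  proof
    assume "\<exists>p. is_cycle T p"
    then obtain p where len: "3 \<le> length p" and dist: "distinct p"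
      and edge: "\<And>k. k < length p \<Longrightarrow> {p ! k, p ! (Suc k mod length p)} \<in> T"
      by (auto simp: is_cycle_def)
    let ?e = "{p ! 0, p ! 1}"
    have "p \<noteq> []" using len by auto
    then have e: "?e \<in> T" using edge[of 0] len by simp
    note [simp] = \<open>p \<noteq> []\<close>
    have ne: "p ! a \<noteq> p ! b" if "a < length p" "b < length p" "a \<noteq> b" for a b
      using dist that by (simp add: nth_eq_iff_index_eq)
    have "(p ! 1, p ! Suc k) \<in> reach (T - {?e})" if "Suc k < length p" for k
      using that
    proof (induction k)
      case (Suc k)
      have "{p ! Suc k, p ! Suc (Suc k)} \<in> T"
        using edge[of "Suc k"] Suc.prems by simp
      moreover have "{p ! Suc k, p ! Suc (Suc k)} \<noteq> ?e"
        using ne[of 0 "Suc k"] ne[of 0 "Suc (Suc k)"] Suc.prems by (auto simp: doubleton_eq_iff)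
      ultimately have "(p ! Suc k, p ! Suc (Suc k)) \<in> reach (T - {?e})"
        by (intro reach_edge) auto
      then show ?case
        using Suc by (meson Suc_lessD reach_trans)
    qed simp
    from this[of "length p - 2"] have "(p ! 1, p ! (length p - 1)) \<in> reach (T - {?e})"
      using len by (simp add: Suc_diff_le numeral_2_eq_2 Suc_diff_Suc)
    moreover have "(p ! (length p - 1), p ! 0) \<in> reach (T - {?e})"
    proof (rule reach_edge)
      have "{p ! (length p - 1), p ! 0} \<in> T"
        using edge[of "length p - 1"] len by simp
      moreover have "{p ! (length p - 1), p ! 0} \<noteq> ?e"
        using ne[of "length p - 1" 0] ne[of "length p - 1" 1] len by (auto simp: doubleton_eq_iff)
      ultimately show "{p ! (length p - 1), p ! 0} \<in> T - {?e}" by simp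
    qed
    ultimately have "(p ! 0, p ! 1) \<in> reach (T - {?e})"
      by (meson reach_sym reach_trans)
    then show False
      using forestD[OF forest e] by simp
  qed
qed

section \<open>Spanning trees of a simple graph\<close>

lemma simple_graph_edge:
  assumes "simple_graph n E" and "{x, y} \<in> E"
  shows "x < n" and "y < n" and "x \<noteq> y"
  using assms by (auto simp: simple_graph_def dest!: bspec)

lemma spanning_trees_eq:
  assumes "simple_graph n E"
  shows "spanning_trees n E = {T. T \<subseteq> E \<and> connected_graph n T \<and> forest T}"
proof -
  have "(\<nexists>p. is_cycle T p) \<longleftrightarrow> forest T" if "T \<subseteq> E" for T
    using that simple_graph_edge(3)[OF assms] by (intro acyclic_iff_forest) (metis insert_absorb2 subsetD)
  then show ?thesis unfolding spanning_trees_def by blast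
qed

lemma finite_simple_graph:
  assumes "simple_graph n E" shows "finite E"
  using assms by (intro finite_subset[of E "Pow {0..<n}"]) (auto simp: simple_graph_def)

lemma finite_spanning_trees:
  assumes "simple_graph n E" shows "finite (spanning_trees n E)"
  by (rule finite_subset[of _ "Pow E"])
    (auto simp: spanning_trees_def finite_simple_graph[OF assms])

text \<open>A connected edge set of least cardinality is a tree, since any edge that is not a bridge
  could be dropped. This permits dividing by \<tau> later.\<close>

lemma num_spanning_trees_pos:
  assumes "simple_graph n E" and "connected_graph n E"
  shows "num_spanning_trees n E > 0"
proof -
  let ?P = "\<lambda>T. T \<subseteq> E \<and> connected_graph n T"
  obtain T where T: "?P T" and min: "\<And>U. ?P U \<Longrightarrow> card T \<le> card U"
    using ex_has_least_nat[of ?P E card] assms by auto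
  have fin: "finite T" using T finite_simple_graph[OF assms(1)] finite_subset by auto
  have "forest T"
    unfolding forest_def
  proof (intro allI impI notI)
    fix x y
    assume xy: "{x, y} \<in> T" and r: "(x, y) \<in> reach (T - {{x, y}})"
    have T_eq: "T = insert {x, y} (T - {{x, y}})" using xy by auto
    have "(u, v) \<in> reach (T - {{x, y}})" if "(u, v) \<in> reach T" for u v
      using that r reach_insert[of u v x y "T - {{x, y}}"] T_eq
      by (metis reach_sym reach_trans)
    then have "?P (T - {{x, y}})"
      using T unfolding connected_graph_reach by auto
    from min[OF this] show False
      using xy fin by (metis card_Diff1_less linorder_not_less)
  qed
  then have "T \<in> spanning_trees n E" using T by (simp add: spanning_trees_eq[OF assms(1)])
  then show ?thesis
    unfolding num_spanning_trees_def
    using finite_spanning_trees[OF assms(1)] by (auto simp: card_gt_0_iff)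
qed

text \<open>In a tree, the neighbour \<open>y\<close> counted here is the one through which the path from \<open>x\<close> to \<open>z\<close>
  leaves \<open>x\<close>.\<close>

lemma tree_exit_neighbour:
  assumes "forest T" and "(z, x) \<in> reach T" and "\<And>v. {x, v} \<in> T \<Longrightarrow> v < n"
  shows "card {y \<in> {..<n}. {x, y} \<in> T \<and> (z, y) \<in> reach (T - {{x, y}})} = (if z = x then 0 else 1)"
proof (cases "z = x")
  case True
  then have "{y \<in> {..<n}. {x, y} \<in> T \<and> (z, y) \<in> reach (T - {{x, y}})} = {}"
    using forestD[OF assms(1)] by blast
  then show ?thesis using True by (simp only: card.empty refl if_True)
next
  case False
  \<comment> \<open>\<open>S\<close> drops all edges at \<open>x\<close>. For a neighbour
    \<open>y\<close>, reaching it from \<open>z\<close> without \<open>{x, y}\<close> is the same as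
    reaching it within \<open>S\<close>: a walk through \<open>x\<close> would join \<open>x\<close>
    and \<open>y\<close> without their edge.\<close>
  define S where "S = {f \<in> T. x \<notin> f}"
  have S_sub: "(u, v) \<in> reach (T - {{x, y}})" if "(u, v) \<in> reach S" for u v y
    using that by (rule reach_mono[rotated]) (auto simp: S_def)
  have to_S: "(z, y) \<in> reach S" if xy: "{x, y} \<in> T" and zy: "(z, y) \<in> reach (T - {{x, y}})" for y
  proof -
    have no: "(y, x) \<notin> reach (T - {{x, y}})"
      using forestD[OF assms(1) xy] by (blast dest: reach_sym)
    have "(y, z) \<in> reach (T - {{x, y}})" using zy by (rule reach_sym)
    then have "(y, z) \<in> reach S"
      unfolding reach_def[of "T - {{x, y}}"]
    proof (induction rule: rtrancl_induct)
      case (step u v)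
      have "(y, u) \<in> reach (T - {{x, y}})" using step.hyps(1) by (simp add: reach_def)
      moreover have "(y, v) \<in> reach (T - {{x, y}})"
        using rtrancl_into_rtrancl[OF step.hyps] by (simp add: reach_def)
      ultimately have "u \<noteq> x" "v \<noteq> x" using no by auto
      then have "{u, v} \<in> S" using step.hyps(2) by (auto simp: S_def)
      then show ?case using step.IH reach_edge reach_trans by metis
    qed simp
    then show ?thesis by (rule reach_sym)
  qed
  \<comment> \<open>Invariant along a walk from \<open>z\<close>: either \<open>x\<close> has not
    been met, or the vertex just before its first visit is a neighbour reached within
    \<open>S\<close>. At \<open>u = x\<close> only the second case is left.\<close>
  have "(z, u) \<in> reach S \<and> u \<noteq> x \<or> (\<exists>y. {x, y} \<in> T \<and> (z, y) \<in> reach S)" if "(z, u) \<in> reach T" for u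
    using that unfolding reach_def[of T]
  proof (induction rule: rtrancl_induct)
    case base
    then show ?case using False by simp
  next
    case (step u v)
    then have uv: "{u, v} \<in> T" by simp
    show ?case
    proof (cases "\<exists>y. {x, y} \<in> T \<and> (z, y) \<in> reach S")
      case no: False
      then have zu: "(z, u) \<in> reach S" "u \<noteq> x" using step.IH by auto
      then have "v \<noteq> x" using no uv by (auto simp: insert_commute)
      then have "{u, v} \<in> S" using uv zu by (auto simp: S_def)
      then have "(z, v) \<in> reach S" using zu reach_edge reach_trans by metis
      then show ?thesis using \<open>v \<noteq> x\<close> by simp
    qed simp
  qed
  from this[OF assms(2)] obtain y where y: "{x, y} \<in> T" "(z, y) \<in> reach S" by auto
  \<comment> \<open>Two such neighbours would be joined within \<open>S\<close>, so going from
    \<open>x\<close> through \<open>y'\<close> to \<open>y\<close> would bypass the bridge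
    \<open>{x, y}\<close>.\<close>
  have unique: "y' = y" if y': "{x, y'} \<in> T" "(z, y') \<in> reach (T - {{x, y'}})" for y'
  proof (rule ccontr)
    assume ne: "y' \<noteq> y"
    have "(y', y) \<in> reach S"
      using y to_S[OF y'] by (meson reach_sym reach_trans)
    then have "(y', y) \<in> reach (T - {{x, y}})" by (rule S_sub)
    moreover have "(x, y') \<in> reach (T - {{x, y}})"
      using y' ne by (intro reach_edge) (auto simp: doubleton_eq_iff)
    ultimately show False
      using forestD[OF assms(1) y(1)] reach_trans by metis
  qed
  have "{y \<in> {..<n}. {x, y} \<in> T \<and> (z, y) \<in> reach (T - {{x, y}})} = {y}"
    using y assms(3) S_sub unique by blast
  then show ?thesis using False by simp
qed

section \<open>The two-component forest potential\<close>

definition separating_forests :: "nat \<Rightarrow> nat set set \<Rightarrow> nat \<Rightarrow> nat \<Rightarrow> nat set set set" where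
  "separating_forests n E s t =
     {F. F \<subseteq> E \<and> forest F \<and> (s, t) \<notin> reach F \<and> (\<forall>v<n. (s, v) \<in> reach F \<or> (t, v) \<in> reach F)}"

text \<open>The spanning trees whose path from \<open>s\<close> to \<open>t\<close> crosses the edge
  from \<open>x\<close> to \<open>y\<close> in this direction: its removal leaves \<open>x\<close>
  on the side of \<open>s\<close> and \<open>y\<close> on the side of \<open>t\<close>.\<close>

definition tree_flow :: "nat \<Rightarrow> nat set set \<Rightarrow> nat \<Rightarrow> nat \<Rightarrow> nat \<Rightarrow> nat \<Rightarrow> nat set set set" where
  "tree_flow n E s t x y = {T \<in> spanning_trees n E. {x, y} \<in> T \<and>
     (s, x) \<in> reach (T - {{x, y}}) \<and> (t, y) \<in> reach (T - {{x, y}})}"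

text \<open>Deleting the edge cuts such a tree into two components, inserting it joins them again,
  and the two operations are mutually inverse.\<close>

lemma card_tree_flow:
  assumes sg: "simple_graph n E" and xy: "{x, y} \<in> E" and st: "s < n" "t < n"
  shows "card (tree_flow n E s t x y) =
    card {F \<in> separating_forests n E s t. (s, x) \<in> reach F \<and> (t, y) \<in> reach F}"
proof -
  let ?A = "{F \<in> separating_forests n E s t. (s, x) \<in> reach F \<and> (t, y) \<in> reach F}"
  let ?e = "{x, y}"
  have notin: "(x, y) \<notin> reach F \<and> ?e \<notin> F" if "F \<in> ?A" for F
  proof -
    have "(x, y) \<notin> reach F"
      using that unfolding separating_forests_def by (blast intro: reach_trans reach_sym)
    then show ?thesis using reach_edge[of x y F] by auto
  qed
  have "bij_betw (insert ?e) ?A (tree_flow n E s t x y)"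
  proof (rule bij_betw_byWitness[of _ "\<lambda>T. T - {?e}"])
    show "\<forall>F\<in>?A. insert ?e F - {?e} = F" using notin by auto
    show "\<forall>T\<in>tree_flow n E s t x y. insert ?e (T - {?e}) = T"
      by (auto simp: tree_flow_def)
    show "insert ?e ` ?A \<subseteq> tree_flow n E s t x y"
    proof (rule image_subsetI)
      fix F assume F: "F \<in> ?A"
      then have F': "F \<subseteq> E" "forest F" "\<And>v. v < n \<Longrightarrow> (s, v) \<in> reach F \<or> (t, v) \<in> reach F"
          "(s, x) \<in> reach F" "(t, y) \<in> reach F"
        by (auto simp: separating_forests_def)
      have sub: "(p, q) \<in> reach F \<Longrightarrow> (p, q) \<in> reach (insert ?e F)" for p q
        by (rule reach_mono) auto
      have "(x, y) \<in> reach (insert ?e F)" by (simp add: reach_edge)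
      then have "(s, v) \<in> reach (insert ?e F)" if "v < n" for v
        using F'(3)[OF that] F'(4,5) by (meson sub reach_sym reach_trans)
      then have "connected_graph n (insert ?e F)"
        unfolding connected_graph_reach by (meson reach_sym reach_trans)
      moreover have "forest (insert ?e F)" using F' notin[OF F] by (intro forest_insert) auto
      ultimately have "insert ?e F \<in> spanning_trees n E"
        using F' xy by (simp add: spanning_trees_eq[OF sg])
      moreover have "insert ?e F - {?e} = F" using notin[OF F] by auto
      ultimately show "insert ?e F \<in> tree_flow n E s t x y"
        using F' by (simp add: tree_flow_def)
    qed
    show "(\<lambda>T. T - {?e}) ` tree_flow n E s t x y \<subseteq> ?A"
    proof (rule image_subsetI)
      fix T assume "T \<in> tree_flow n E s t x y"
      then have T: "T \<subseteq> E" "connected_graph n T" "forest T" "?e \<in> T"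
          "(s, x) \<in> reach (T - {?e})" "(t, y) \<in> reach (T - {?e})"
        by (auto simp: tree_flow_def spanning_trees_eq[OF sg])
      have bridge: "(x, y) \<notin> reach (T - {?e})" using T forestD by metis
      have T_eq: "T = insert ?e (T - {?e})" using T by auto
      have "(s, v) \<in> reach (T - {?e}) \<or> (t, v) \<in> reach (T - {?e})" if "v < n" for v
      proof -
        have "(s, v) \<in> reach (insert ?e (T - {?e}))"
          using T(2) that st T_eq unfolding connected_graph_reach by metis
        then show ?thesis
          unfolding reach_insert using T(5,6) by (meson reach_sym reach_trans)
      qed
      moreover have "(s, t) \<notin> reach (T - {?e})"
        using bridge T(5,6) by (meson reach_sym reach_trans)
      moreover have "forest (T - {?e})" using T by (auto intro: forest_subset)
      ultimately show "T - {?e} \<in> ?A"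
        using T by (auto simp: separating_forests_def)
    qed
  qed
  then show ?thesis by (simp add: bij_betw_same_card)
qed

lemma finite_separating_forests:
  assumes "simple_graph n E" shows "finite (separating_forests n E s t)"
  by (rule finite_subset[of _ "Pow E"])
    (auto simp: separating_forests_def finite_simple_graph[OF assms])

definition forest_potential :: "nat \<Rightarrow> nat set set \<Rightarrow> nat \<Rightarrow> nat \<Rightarrow> nat \<Rightarrow> nat" where
  "forest_potential n E s t x = card {F \<in> separating_forests n E s t. (s, x) \<in> reach F}"

text \<open>Sort the forests counted at one endpoint by the component of the other endpoint. Those
  with both endpoints on the side of \<open>s\<close> cancel, and the rest correspond to trees by
  \<open>card_tree_flow\<close>.\<close>

lemma forest_potential_diff:
  assumes sg: "simple_graph n E" and xy: "{x, y} \<in> E" and st: "s < n" "t < n"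
  shows "real (forest_potential n E s t x) - real (forest_potential n E s t y) =
    real (card (tree_flow n E s t x y)) - real (card (tree_flow n E s t y x))"
proof -
  let ?S = "separating_forests n E s t"
  have lt: "x < n" "y < n" using simple_graph_edge[OF sg xy] by auto
  have fin: "finite {F \<in> ?S. P F}" for P using finite_separating_forests[OF sg] by simp
  have split: "forest_potential n E s t u = card {F \<in> ?S. (s, u) \<in> reach F \<and> (s, v) \<in> reach F} +
      card {F \<in> ?S. (s, u) \<in> reach F \<and> (t, v) \<in> reach F}" if "v < n" for u v
  proof -
    have "{F \<in> ?S. (s, u) \<in> reach F} = {F \<in> ?S. (s, u) \<in> reach F \<and> (s, v) \<in> reach F} \<union>
        {F \<in> ?S. (s, u) \<in> reach F \<and> (t, v) \<in> reach F}"
      using that by (auto simp: separating_forests_def)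
    moreover have "{F \<in> ?S. (s, u) \<in> reach F \<and> (s, v) \<in> reach F} \<inter>
        {F \<in> ?S. (s, u) \<in> reach F \<and> (t, v) \<in> reach F} = {}"
      by (auto simp: separating_forests_def dest: reach_sym reach_trans)
    ultimately show ?thesis
      unfolding forest_potential_def by (simp add: card_Un_disjoint fin)
  qed
  have comm: "{F \<in> ?S. (s, x) \<in> reach F \<and> (s, y) \<in> reach F} =
      {F \<in> ?S. (s, y) \<in> reach F \<and> (s, x) \<in> reach F}"
    by auto
  have yx: "{y, x} \<in> E" using xy by (simp add: insert_commute)
  show ?thesis
    using split[OF lt(2), of x] split[OF lt(1), of y]
    by (simp add: card_tree_flow[OF sg xy st] card_tree_flow[OF sg yx st] comm)
qed

text \<open>Exchanging the sums over neighbours and over trees reduces Kirchhoff's current law to a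
  single tree.\<close>

lemma forest_potential_net_flow:
  assumes sg: "simple_graph n E" and st: "s < n" "t < n" and x: "x < n"
  shows "(\<Sum>y<n. if {x, y} \<in> E
            then real (forest_potential n E s t x) - real (forest_potential n E s t y) else 0) =
    real (num_spanning_trees n E) * (of_bool (x = s) - of_bool (x = t))"
proof -
  let ?T = "spanning_trees n E"
  have fin: "finite ?T" by (rule finite_spanning_trees[OF sg])
  have tree_sum: "(\<Sum>y<n. of_bool (T \<in> tree_flow n E s t x y) - of_bool (T \<in> tree_flow n E s t y x)) =
      (of_bool (x = s) - of_bool (x = t) :: real)" if TT: "T \<in> ?T" for T
  proof -
    have T: "T \<subseteq> E" "connected_graph n T" "forest T"
      using that by (auto simp: spanning_trees_eq[OF sg])
    have lt: "v < n" if "{x, v} \<in> T" for v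
      using that T simple_graph_edge[OF sg] by blast
    let ?N = "\<lambda>z. {y \<in> {..<n}. {x, y} \<in> T \<and> (z, y) \<in> reach (T - {{x, y}})}"
    \<comment> \<open>Each vertex lies on exactly one side of a removed tree edge.\<close>
    have dich: "(z, x) \<in> reach (T - {{x, y}}) \<longleftrightarrow> (z, y) \<notin> reach (T - {{x, y}})"
      if "{x, y} \<in> T" "z < n" for y z
    proof -
      have "(x, z) \<in> reach (insert {x, y} (T - {{x, y}}))"
        using T x that unfolding connected_graph_reach by (simp add: insert_absorb)
      then have "(z, x) \<in> reach (T - {{x, y}}) \<or> (z, y) \<in> reach (T - {{x, y}})"
        unfolding reach_insert by (meson reach_sym)
      then show ?thesis
        using forestD[OF T(3) that(1)] by (meson reach_sym reach_trans)
    qed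
    \<comment> \<open>If \<open>s\<close> and \<open>t\<close> lie on the same side of
      \<open>{x, y}\<close>, both differences vanish; otherwise both give the sign of the crossing.
      The flow thus separates into one neighbour count for \<open>t\<close> and one for
      \<open>s\<close>, each known from \<open>tree_exit_neighbour\<close>.\<close>
    have edge: "of_bool (T \<in> tree_flow n E s t x y) - of_bool (T \<in> tree_flow n E s t y x) =
        (of_bool (y \<in> ?N t) - of_bool (y \<in> ?N s) :: real)" if "y < n" for y
      using dich[of y s] dich[of y t] st that TT by (auto simp: tree_flow_def insert_commute)
    have count: "(\<Sum>y<n. of_bool (y \<in> ?N z)) = (of_bool (z \<noteq> x) :: real)" if "z < n" for z
    proof -
      have "{..<n} \<inter> {y. y \<in> ?N z} = ?N z" by blast
      then have "(\<Sum>y<n. of_bool (y \<in> ?N z)) = real (card (?N z))"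
        by (simp add: of_bool_def sum.If_cases Int_def)
      also have "card (?N z) = (if z = x then 0 else 1)"
        using T x that lt by (intro tree_exit_neighbour) (auto simp: connected_graph_reach)
      finally show ?thesis by simp
    qed
    have "(\<Sum>y<n. of_bool (T \<in> tree_flow n E s t x y) - of_bool (T \<in> tree_flow n E s t y x)) =
        (\<Sum>y<n. of_bool (y \<in> ?N t) - of_bool (y \<in> ?N s) :: real)"
      by (rule sum.cong[OF refl edge]) simp
    also have "\<dots> = of_bool (t \<noteq> x) - of_bool (s \<noteq> x)"
      unfolding sum_subtractf count[OF st(1)] count[OF st(2)] ..
    finally show ?thesis by auto
  qed
  have card_flow: "real (card (tree_flow n E s t u v)) = (\<Sum>T\<in>?T. of_bool (T \<in> tree_flow n E s t u v))" for u v
  proof -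
    have "?T \<inter> {T. T \<in> tree_flow n E s t u v} = tree_flow n E s t u v" by (auto simp: tree_flow_def)
    then show ?thesis by (simp add: of_bool_def sum.If_cases fin)
  qed
  have "(\<Sum>y<n. if {x, y} \<in> E
            then real (forest_potential n E s t x) - real (forest_potential n E s t y) else 0) =
      (\<Sum>y<n. real (card (tree_flow n E s t x y)) - real (card (tree_flow n E s t y x)))"
  proof (rule sum.cong[OF refl])
    fix y
    have "tree_flow n E s t x y = {} \<and> tree_flow n E s t y x = {}" if "{x, y} \<notin> E"
      using that by (auto simp: tree_flow_def spanning_trees_def insert_commute)
    then show "(if {x, y} \<in> E
        then real (forest_potential n E s t x) - real (forest_potential n E s t y) else 0) =
        real (card (tree_flow n E s t x y)) - real (card (tree_flow n E s t y x))"
      using forest_potential_diff[OF sg _ st] by auto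
  qed
  also have "\<dots> = (\<Sum>T\<in>?T. \<Sum>y<n. of_bool (T \<in> tree_flow n E s t x y) - of_bool (T \<in> tree_flow n E s t y x))"
    unfolding card_flow sum_subtractf[symmetric] by (rule sum.swap)
  also have "\<dots> = (\<Sum>T\<in>?T. of_bool (x = s) - of_bool (x = t))"
    by (rule sum.cong[OF refl tree_sum])
  finally show ?thesis by (simp add: num_spanning_trees_def)
qed

text \<open>Every separating forest is counted at \<open>s\<close> and none at \<open>t\<close>.
  Adding the edge \<open>{s, t}\<close> turns these forests into exactly the trees through
  it.\<close>

lemma forest_potential_edge:
  assumes sg: "simple_graph n E" and st: "{s, t} \<in> E"
  shows "forest_potential n E s t s = num_spanning_trees_containing n E {s, t}"
    and "forest_potential n E s t t = 0"
proof -
  have lt: "s < n" "t < n" using simple_graph_edge[OF sg st] by auto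
  have "forest_potential n E s t s =
      card {F \<in> separating_forests n E s t. (s, s) \<in> reach F \<and> (t, t) \<in> reach F}"
    by (simp add: forest_potential_def)
  also have "\<dots> = card (tree_flow n E s t s t)"
    using card_tree_flow[OF sg st lt] by simp
  finally show "forest_potential n E s t s = num_spanning_trees_containing n E {s, t}"
    by (simp add: tree_flow_def num_spanning_trees_containing_def)
  have "{F \<in> separating_forests n E s t. (s, t) \<in> reach F} = {}"
    by (auto simp: separating_forests_def)
  then show "forest_potential n E s t t = 0"
    unfolding forest_potential_def by (simp only: card.empty)
qed

section \<open>Effective resistance\<close>

lemma laplacian_carrier [simp]: "laplacian n E w \<in> carrier_mat n n"
  unfolding laplacian_def by (intro minus_carrier_mat) (simp add: adjacency_matrix_def)

lemma laplacian_dim: "dim_row (laplacian n E w) = n" "dim_col (laplacian n E w) = n"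
  using laplacian_carrier[of n E w] unfolding carrier_mat_def by auto

lemma laplacian_mult_vec:
  fixes w :: "nat set \<Rightarrow> 'a::comm_ring_1"
  assumes v: "v \<in> carrier_vec n" and s: "s < n"
  shows "(laplacian n E w *\<^sub>v v) $ s = (\<Sum>u<n. if {s, u} \<in> E then w {s, u} * (v $ s - v $ u) else 0)"
proof -
  have "(laplacian n E w *\<^sub>v v) $ s = (\<Sum>u<n. laplacian n E w $$ (s, u) * v $ u)"
    using assms by (auto simp: laplacian_dim scalar_prod_def lessThan_atLeast0 intro!: sum.cong)
  also have "\<dots> = (\<Sum>u<n. (if s = u then (\<Sum>k<n. if {s, k} \<in> E then w {s, k} else 0) * v $ u else 0)
      - (if {s, u} \<in> E then w {s, u} * v $ u else 0))"
    using s by (intro sum.cong refl)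
      (auto simp: laplacian_def degree_matrix_def adjacency_matrix_def algebra_simps)
  also have "\<dots> = (\<Sum>k<n. if {s, k} \<in> E then w {s, k} else 0) * v $ s
      - (\<Sum>u<n. if {s, u} \<in> E then w {s, u} * v $ u else 0)"
    using s by (simp add: sum_subtractf)
  also have "\<dots> = (\<Sum>u<n. if {s, u} \<in> E then w {s, u} * (v $ s - v $ u) else 0)"
    unfolding sum_distrib_right sum_subtractf[symmetric]
    by (rule sum.cong) (auto simp: algebra_simps)
  finally show ?thesis .
qed

text \<open>Resolves the definite description: if the kernel consists of constants, any admissible
  potential for current \<open>Y\<close> differs from \<open>Y\<close> times \<open>f\<close> by a
  constant. Stated for a general algebra, it serves both real and dual weights.\<close>

lemma eff_resistance_eqI:
  fixes w :: "nat set \<Rightarrow> 'a::{comm_ring_1, real_algebra_1}"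
  assumes f: "f \<in> carrier_vec n" "laplacian n E w *\<^sub>v f = unit_vec n s - unit_vec n t"
    and harmonic: "\<And>v x y. v \<in> carrier_vec n \<Longrightarrow> laplacian n E w *\<^sub>v v = 0\<^sub>v n \<Longrightarrow> x < n \<Longrightarrow> y < n \<Longrightarrow> v $ x = v $ y"
    and st: "s < n" "t < n"
  shows "eff_resistance n E w s t = f $ s - f $ t"
proof (cases "s = t")
  case False
  let ?L = "laplacian n E w"
  have "(THE r. \<exists>Y::real. \<exists>v\<in>carrier_vec n. Y > 0 \<and>
        ?L *\<^sub>v v = of_real Y \<cdot>\<^sub>v (unit_vec n s - unit_vec n t) \<and> r = (v $ s - v $ t) /\<^sub>R Y) = f $ s - f $ t"
  proof (rule the_equality)
    show "\<exists>Y::real. \<exists>v\<in>carrier_vec n. Y > 0 \<and>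
        ?L *\<^sub>v v = of_real Y \<cdot>\<^sub>v (unit_vec n s - unit_vec n t) \<and> f $ s - f $ t = (v $ s - v $ t) /\<^sub>R Y"
      using f by (intro exI[of _ 1] bexI[of _ f]) auto
  next
    fix r
    assume "\<exists>Y::real. \<exists>v\<in>carrier_vec n. Y > 0 \<and>
        ?L *\<^sub>v v = of_real Y \<cdot>\<^sub>v (unit_vec n s - unit_vec n t) \<and> r = (v $ s - v $ t) /\<^sub>R Y"
    then obtain Y :: real and v where Y: "Y > 0" and v: "v \<in> carrier_vec n"
      and Lv: "?L *\<^sub>v v = of_real Y \<cdot>\<^sub>v (unit_vec n s - unit_vec n t)"
      and r: "r = (v $ s - v $ t) /\<^sub>R Y"
      by blast
    define g where "g = v - of_real Y \<cdot>\<^sub>v f"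
    have g: "g \<in> carrier_vec n" using v f by (simp add: g_def)
    have "?L *\<^sub>v (of_real Y \<cdot>\<^sub>v f) = of_real Y \<cdot>\<^sub>v (?L *\<^sub>v f)"
    proof (rule eq_vecI)
      fix x assume "x < dim_vec (of_real Y \<cdot>\<^sub>v (?L *\<^sub>v f))"
      then have x: "x < n" by (simp add: laplacian_dim)
      have "(of_real Y \<cdot>\<^sub>v (?L *\<^sub>v f)) $ x = of_real Y * (?L *\<^sub>v f) $ x"
        using x by (intro index_smult_vec(1)) (simp add: laplacian_dim)
      then show "(?L *\<^sub>v (of_real Y \<cdot>\<^sub>v f)) $ x = (of_real Y \<cdot>\<^sub>v (?L *\<^sub>v f)) $ x"
        using laplacian_mult_vec[OF f(1) x, of E w]
          laplacian_mult_vec[OF smult_carrier_vec[THEN iffD2, OF f(1)] x, of E w "of_real Y"] f(1) x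
        by (simp only:) (auto simp: sum_distrib_left algebra_simps intro!: sum.cong)
    qed simp
    then have "?L *\<^sub>v g = ?L *\<^sub>v v - of_real Y \<cdot>\<^sub>v (?L *\<^sub>v f)"
      unfolding g_def using v f
      by (simp add: mult_minus_distrib_mat_vec[OF laplacian_carrier])
    also have "\<dots> = 0\<^sub>v n" using Lv f by simp
    finally have "g $ s = g $ t" using harmonic g st by blast
    then have "v $ s - v $ t = of_real Y * (f $ s - f $ t)"
      using v f st by (simp add: g_def algebra_simps)
    then show "r = f $ s - f $ t"
      using Y r by (simp add: scaleR_conv_of_real[symmetric])
  qed
  then show ?thesis using False by (simp add: eff_resistance_def)
qed (simp add: eff_resistance_def)

section \<open>The Dirichlet form and harmonic vectors\<close>

text \<open>The quadratic form of the Laplacian is the Dirichlet form, here polarised and doubled.\<close>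

lemma laplacian_dirichlet_form:
  fixes u v :: "real vec"
  assumes "v \<in> carrier_vec n"
  shows "2 * (\<Sum>x<n. u $ x * (laplacian n E unit_weight *\<^sub>v v) $ x) =
    (\<Sum>x<n. \<Sum>y<n. if {x, y} \<in> E then (u $ x - u $ y) * (v $ x - v $ y) else 0)"
proof -
  let ?S = "\<Sum>x<n. \<Sum>y<n. if {x, y} \<in> E then u $ x * (v $ x - v $ y) else 0"
  have S: "(\<Sum>x<n. u $ x * (laplacian n E unit_weight *\<^sub>v v) $ x) = ?S"
    by (intro sum.cong refl)
      (auto simp: laplacian_mult_vec[OF assms] sum_distrib_left unit_weight_def intro!: sum.cong)
  \<comment> \<open>Averaging with the copy in which \<open>x\<close> and \<open>y\<close> are
    exchanged symmetrises the summand.\<close>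
  have "?S = (\<Sum>y<n. \<Sum>x<n. if {x, y} \<in> E then u $ x * (v $ x - v $ y) else 0)"
    by (rule sum.swap)
  also have "\<dots> = (\<Sum>x<n. \<Sum>y<n. if {x, y} \<in> E then u $ y * (v $ y - v $ x) else 0)"
    by (simp add: insert_commute)
  finally have "2 * ?S = (\<Sum>x<n. \<Sum>y<n. if {x, y} \<in> E then u $ x * (v $ x - v $ y) else 0) +
      (\<Sum>x<n. \<Sum>y<n. if {x, y} \<in> E then u $ y * (v $ y - v $ x) else 0)"
    by simp
  also have "\<dots> = (\<Sum>x<n. \<Sum>y<n. if {x, y} \<in> E then (u $ x - u $ y) * (v $ x - v $ y) else 0)"
    unfolding sum.distrib[symmetric] by (intro sum.cong refl) (auto simp: algebra_simps)
  finally show ?thesis by (simp only: S)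
qed

lemma laplacian_symmetric_form:
  fixes u v :: "real vec"
  assumes "u \<in> carrier_vec n" "v \<in> carrier_vec n"
  shows "(\<Sum>x<n. u $ x * (laplacian n E unit_weight *\<^sub>v v) $ x) =
    (\<Sum>x<n. v $ x * (laplacian n E unit_weight *\<^sub>v u) $ x)"
proof -
  have "2 * (\<Sum>x<n. u $ x * (laplacian n E unit_weight *\<^sub>v v) $ x) =
    2 * (\<Sum>x<n. v $ x * (laplacian n E unit_weight *\<^sub>v u) $ x)"
    unfolding laplacian_dirichlet_form[OF assms(1)] laplacian_dirichlet_form[OF assms(2)]
    by (simp add: mult.commute cong: if_cong)
  then show ?thesis by simp
qed

text \<open>The Dirichlet form of \<open>v\<close> with itself vanishes, so \<open>v\<close> agrees
  across every edge, and connectedness spreads the common value.\<close>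

lemma laplacian_harmonic_const:
  fixes v :: "real vec"
  assumes con: "connected_graph n E" and v: "v \<in> carrier_vec n"
    and harmonic: "laplacian n E unit_weight *\<^sub>v v = 0\<^sub>v n" and xy: "x < n" "y < n"
    and sg: "simple_graph n E"
  shows "v $ x = v $ y"
proof -
  let ?D = "\<lambda>x y. if {x, y} \<in> E then (v $ x - v $ y) * (v $ x - v $ y) else 0"
  have nonneg: "?D p q \<ge> 0" for p q by simp
  have "(\<Sum>x<n. \<Sum>y<n. ?D x y) = 0"
    using laplacian_dirichlet_form[OF v, of v E] harmonic by simp
  then have D: "?D p q = 0" if "p < n" "q < n" for p q
    using that nonneg by (auto simp: sum_nonneg_eq_0_iff sum_nonneg)
  have edge: "v $ p = v $ q" if "{p, q} \<in> E" for p q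
    using D[of p q] simple_graph_edge[OF sg that] that by simp
  have "(x, y) \<in> reach E" using con xy by (simp add: connected_graph_reach)
  then show ?thesis
    unfolding reach_def by (induction rule: rtrancl_induct) (use edge in auto)
qed

text \<open>Kirchhoff's potential rescaled from current \<tau> to current 1. It is not normalised to
  mean zero; only voltages matter until the Kirchhoff index.\<close>

definition unit_potential :: "nat \<Rightarrow> nat set set \<Rightarrow> nat \<Rightarrow> nat \<Rightarrow> real vec" where
  "unit_potential n E s t =
     vec n (\<lambda>x. real (forest_potential n E s t x) / real (num_spanning_trees n E))"

lemma unit_potential_carrier [simp]: "unit_potential n E s t \<in> carrier_vec n"
  by (simp add: unit_potential_def)

lemma laplacian_unit_potential:
  assumes sg: "simple_graph n E" and con: "connected_graph n E" and st: "s < n" "t < n"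
  shows "laplacian n E unit_weight *\<^sub>v unit_potential n E s t = unit_vec n s - unit_vec n t"
proof (rule eq_vecI)
  fix x assume "x < dim_vec (unit_vec n s - unit_vec n t :: real vec)"
  then have x: "x < n" by simp
  let ?p = "\<lambda>x. real (forest_potential n E s t x)" and ?\<tau> = "real (num_spanning_trees n E)"
  have "(laplacian n E unit_weight *\<^sub>v unit_potential n E s t) $ x =
      (\<Sum>y<n. (if {x, y} \<in> E then ?p x - ?p y else 0) / ?\<tau>)"
    using x by (auto simp: laplacian_mult_vec unit_weight_def unit_potential_def diff_divide_distrib
        intro!: sum.cong)
  also have "\<dots> = of_bool (x = s) - of_bool (x = t)"
    unfolding sum_divide_distrib[symmetric] forest_potential_net_flow[OF sg st x]
    using num_spanning_trees_pos[OF sg con] by simp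
  finally show "(laplacian n E unit_weight *\<^sub>v unit_potential n E s t) $ x =
      (unit_vec n s - unit_vec n t) $ x"
    using x st by (auto simp: unit_vec_def)
qed (simp add: laplacian_dim)

lemma eff_resistance_unit_weight:
  assumes sg: "simple_graph n E" and con: "connected_graph n E" and st: "s < n" "t < n"
  shows "eff_resistance n E unit_weight s t = unit_potential n E s t $ s - unit_potential n E s t $ t"
  by (rule eff_resistance_eqI[OF unit_potential_carrier laplacian_unit_potential[OF assms]
        laplacian_harmonic_const[OF con _ _ _ _ sg] st])

theorem eff_resistance_edge:
  assumes sg: "simple_graph n E" and con: "connected_graph n E" and st: "{s, t} \<in> E"
  shows "eff_resistance n E unit_weight s t =
    real (num_spanning_trees_containing n E {s, t}) / real (num_spanning_trees n E)"
proof -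
  have "s < n" "t < n" using simple_graph_edge[OF sg st] by auto
  then show ?thesis
    by (simp add: eff_resistance_unit_weight[OF sg con] unit_potential_def
        forest_potential_edge[OF sg st])
qed

text \<open>Reciprocity of electrical networks: pairing each potential with the source vector of the
  other gives the same value because the Laplacian is symmetric.\<close>

lemma unit_potential_reciprocity:
  assumes sg: "simple_graph n E" and con: "connected_graph n E"
    and lt: "s < n" "t < n" "i < n" "j < n"
  shows "unit_potential n E s t $ i - unit_potential n E s t $ j =
    unit_potential n E i j $ s - unit_potential n E i j $ t"
proof -
  have pick: "(\<Sum>x<n. v $ x * (unit_vec n p - unit_vec n q) $ x) = v $ p - v $ q"
    if "p < n" "q < n" for v :: "real vec" and p q
  proof -
    have "(\<Sum>x<n. v $ x * (unit_vec n p - unit_vec n q) $ x) =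
        (\<Sum>x<n. (if x = p then v $ x else 0) - (if x = q then v $ x else 0))"
      using that by (intro sum.cong) (auto simp: unit_vec_def)
    then show ?thesis using that by (simp add: sum_subtractf)
  qed
  have "(\<Sum>x<n. unit_potential n E s t $ x * (laplacian n E unit_weight *\<^sub>v unit_potential n E i j) $ x) =
      (\<Sum>x<n. unit_potential n E i j $ x * (laplacian n E unit_weight *\<^sub>v unit_potential n E s t) $ x)"
    by (rule laplacian_symmetric_form) simp_all
  then show ?thesis
    unfolding laplacian_unit_potential[OF sg con lt(1,2)] laplacian_unit_potential[OF sg con lt(3,4)]
      pick[OF lt(1,2)] pick[OF lt(3,4)] .
qed

section \<open>Dual number perturbation\<close>

lemma std_part_simps [simp]:
  "std_part 0 = 0" "std_part 1 = 1" "std_part (x + y) = std_part x + std_part y"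
  "std_part (x - y) = std_part x - std_part y" "std_part (x * y) = std_part x * std_part y"
  "std_part (of_real c) = c" "std_part \<epsilon> = 0"
  by (simp_all add: zero_dual_num_def one_dual_num_def plus_dual_num_def minus_dual_num_def
      times_dual_num_def of_real_def scaleR_dual_num_def dual_eps_def)

lemma inf_part_simps [simp]:
  "inf_part 0 = 0" "inf_part 1 = 0" "inf_part (x + y) = inf_part x + inf_part y"
  "inf_part (x - y) = inf_part x - inf_part y"
  "inf_part (x * y) = std_part x * inf_part y + inf_part x * std_part y"
  "inf_part (of_real c) = 0" "inf_part \<epsilon> = 1"
  by (simp_all add: zero_dual_num_def one_dual_num_def plus_dual_num_def minus_dual_num_def
      times_dual_num_def of_real_def scaleR_dual_num_def dual_eps_def)

lemma std_part_sum: "std_part (sum f A) = (\<Sum>x\<in>A. std_part (f x))"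
  by (induction A rule: infinite_finite_induct) auto

lemma inf_part_sum: "inf_part (sum f A) = (\<Sum>x\<in>A. inf_part (f x))"
  by (induction A rule: infinite_finite_induct) auto

lemma std_part_perturbed_laplacian:
  assumes "v \<in> carrier_vec n" and "x < n"
  shows "std_part ((laplacian n E (perturbed_weight e a) *\<^sub>v v) $ x) =
    (laplacian n E unit_weight *\<^sub>v map_vec std_part v) $ x"
  using assms
  by (auto simp: laplacian_mult_vec perturbed_weight_def unit_weight_def std_part_sum intro!: sum.cong)

text \<open>The change of weight is infinitesimal, so it meets only the standard part of
  \<open>v\<close>. It contributes the current \<open>a\<close> times the voltage across
  \<open>{i, j}\<close>, with opposite signs at the two ends.\<close>

lemma inf_part_perturbed_laplacian:
  assumes v: "v \<in> carrier_vec n" and x: "x < n" and e: "{i, j} \<in> E" and ij: "i < n" "j < n" "i \<noteq> j"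
  shows "inf_part ((laplacian n E (perturbed_weight {i, j} a) *\<^sub>v v) $ x) =
    (laplacian n E unit_weight *\<^sub>v map_vec inf_part v) $ x +
    a * (std_part (v $ i) - std_part (v $ j)) * (of_bool (x = i) - of_bool (x = j))"
proof -
  let ?d = "\<lambda>y. std_part (v $ x) - std_part (v $ y)"
  have "inf_part ((laplacian n E (perturbed_weight {i, j} a) *\<^sub>v v) $ x) =
      (\<Sum>y<n. (if {x, y} \<in> E then inf_part (v $ x) - inf_part (v $ y) else 0) +
        (if {x, y} = {i, j} then a * ?d y else 0))"
    using e by (auto simp: laplacian_mult_vec[OF v x] perturbed_weight_def inf_part_sum intro!: sum.cong)
  also have "\<dots> = (laplacian n E unit_weight *\<^sub>v map_vec inf_part v) $ x +
      (\<Sum>y<n. if {x, y} = {i, j} then a * ?d y else 0)"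
    using v x by (auto simp: sum.distrib laplacian_mult_vec unit_weight_def intro!: sum.cong)
  \<comment> \<open>The two orientations of the edge exclude each other because \<open>i\<close> and
    \<open>j\<close> differ.\<close>
  also have "(\<Sum>y<n. if {x, y} = {i, j} then a * ?d y else 0) =
      (\<Sum>y<n. (if y = j then of_bool (x = i) * (a * ?d y) else 0) +
        (if y = i then of_bool (x = j) * (a * ?d y) else 0))"
    using ij by (intro sum.cong) (auto simp: doubleton_eq_iff)
  also have "\<dots> = a * (std_part (v $ i) - std_part (v $ j)) * (of_bool (x = i) - of_bool (x = j))"
    using ij by (auto simp: sum.distrib algebra_simps)
  finally show ?thesis .
qed

text \<open>The standard part is harmonic for unit weights, hence constant. This removes the extra
  current at \<open>{i, j}\<close>, so the infinitesimal part is harmonic as well.\<close>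

lemma perturbed_harmonic_const:
  assumes sg: "simple_graph n E" and con: "connected_graph n E" and e: "{i, j} \<in> E"
    and v: "v \<in> carrier_vec n" and harmonic: "laplacian n E (perturbed_weight {i, j} a) *\<^sub>v v = 0\<^sub>v n"
    and xy: "x < n" "y < n"
  shows "v $ x = v $ y"
proof -
  have ij: "i < n" "j < n" "i \<noteq> j" using simple_graph_edge[OF sg e] by auto
  have "(laplacian n E unit_weight *\<^sub>v map_vec std_part v) $ p = 0" if "p < n" for p
    using std_part_perturbed_laplacian[OF v that, of E "{i, j}" a] that unfolding harmonic by simp
  then have "laplacian n E unit_weight *\<^sub>v map_vec std_part v = 0\<^sub>v n"
    by (intro eq_vecI) (simp_all only: laplacian_dim dim_mult_mat_vec index_zero_vec)
  moreover have "map_vec std_part v \<in> carrier_vec n" using v by simp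
  ultimately have "map_vec std_part v $ p = map_vec std_part v $ q" if "p < n" "q < n" for p q
    using laplacian_harmonic_const[OF con _ _ that sg] by blast
  then have std: "std_part (v $ p) = std_part (v $ q)" if "p < n" "q < n" for p q
    using v that by (metis carrier_vecD index_map_vec(1))
  have "(laplacian n E unit_weight *\<^sub>v map_vec inf_part v) $ p = 0" if "p < n" for p
    using inf_part_perturbed_laplacian[OF v that e ij, of a] that
    unfolding harmonic std[OF ij(1,2)] by simp
  then have "laplacian n E unit_weight *\<^sub>v map_vec inf_part v = 0\<^sub>v n"
    by (intro eq_vecI) (simp_all only: laplacian_dim dim_mult_mat_vec index_zero_vec)
  moreover have "map_vec inf_part v \<in> carrier_vec n" using v by simp
  ultimately have "map_vec inf_part v $ x = map_vec inf_part v $ y"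
    using laplacian_harmonic_const[OF con _ _ xy sg] by blast
  then have "inf_part (v $ x) = inf_part (v $ y)"
    using v xy by (metis carrier_vecD index_map_vec(1))
  with std[OF xy] show ?thesis by (simp add: dual_num_eq_iff)
qed

text \<open>First-order perturbation: the perturbed edge acts as a current source proportional to the
  voltage across it.\<close>

lemma eff_resistance_perturbed:
  assumes sg: "simple_graph n E" and con: "connected_graph n E" and e: "{i, j} \<in> E"
    and st: "s < n" "t < n"
  shows "eff_resistance n E (perturbed_weight {i, j} a) s t =
    Dual (eff_resistance n E unit_weight s t)
      (- a * (unit_potential n E i j $ s - unit_potential n E i j $ t)\<^sup>2)"
proof -
  have ij: "i < n" "j < n" "i \<noteq> j" using simple_graph_edge[OF sg e] by auto
  let ?L = "laplacian n E (perturbed_weight {i, j} a)"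
  define p where "p = unit_potential n E s t"
  define u where "u = unit_potential n E i j"
  have p: "p \<in> carrier_vec n" "laplacian n E unit_weight *\<^sub>v p = unit_vec n s - unit_vec n t"
    using laplacian_unit_potential[OF sg con st] by (auto simp: p_def)
  have u: "u \<in> carrier_vec n" "laplacian n E unit_weight *\<^sub>v u = unit_vec n i - unit_vec n j"
    using laplacian_unit_potential[OF sg con ij(1,2)] by (auto simp: u_def)
  \<comment> \<open>The infinitesimal response is sought as a multiple of \<open>u\<close>; this
    \<open>c\<close> makes its source cancel the current that the perturbed edge injects at
    \<open>i\<close> and \<open>j\<close>.\<close>
  define c where "c = - a * (p $ i - p $ j)"
  define f where "f = vec n (\<lambda>x. Dual (p $ x) (c * u $ x))"
  have f: "f \<in> carrier_vec n" by (simp add: f_def)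
  have fstd: "map_vec std_part f = p" using p(1) by (intro eq_vecI) (auto simp: f_def)
  have finf: "map_vec inf_part f = c \<cdot>\<^sub>v u" using u(1) by (intro eq_vecI) (auto simp: f_def)
  have "?L *\<^sub>v f = unit_vec n s - unit_vec n t"
  proof (rule eq_vecI)
    fix x assume "x < dim_vec (unit_vec n s - unit_vec n t :: dual_num vec)"
    then have x: "x < n" by simp
    have "std_part ((?L *\<^sub>v f) $ x) = of_bool (x = s) - of_bool (x = t)"
      using x st by (simp add: std_part_perturbed_laplacian[OF f x] fstd p(2) unit_vec_def)
    moreover have "inf_part ((?L *\<^sub>v f) $ x) = 0"
    proof -
      have "(laplacian n E unit_weight *\<^sub>v (c \<cdot>\<^sub>v u)) $ x = c * (of_bool (x = i) - of_bool (x = j))"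
        using x ij u by (simp add: mult_mat_vec[OF laplacian_carrier] unit_vec_def)
      then show ?thesis
        using ij by (simp add: inf_part_perturbed_laplacian[OF f x e ij] finf)
          (simp add: f_def c_def algebra_simps)
    qed
    ultimately show "(?L *\<^sub>v f) $ x = (unit_vec n s - unit_vec n t) $ x"
      using x st by (auto simp: dual_num_eq_iff unit_vec_def)
  qed (simp add: laplacian_dim)
  then have "eff_resistance n E (perturbed_weight {i, j} a) s t = f $ s - f $ t"
    by (rule eff_resistance_eqI[OF f _ perturbed_harmonic_const[OF sg con e] st])
  \<comment> \<open>Reciprocity converts the voltage hidden in \<open>c\<close> into that of
    \<open>u\<close> between \<open>s\<close> and \<open>t\<close>, which produces the
    square.\<close>
  moreover have "p $ i - p $ j = u $ s - u $ t"
    unfolding p_def u_def by (rule unit_potential_reciprocity[OF sg con st ij(1,2)])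
  ultimately show ?thesis
    using st by (simp add: dual_num_eq_iff f_def c_def eff_resistance_unit_weight[OF sg con st]
        p_def[symmetric] u_def[symmetric] power2_eq_square algebra_simps)
qed

section \<open>Increments of the resistances and of the Kirchhoff index\<close>

lemma Delta_resistance_eq:
  assumes "simple_graph n E" and "connected_graph n E" and "{i, j} \<in> E" and "s < n" "t < n"
  shows "Delta_resistance n E {i, j} a s t =
    - a * (unit_potential n E i j $ s - unit_potential n E i j $ t)\<^sup>2"
  by (simp add: Delta_resistance_def eff_resistance_perturbed[OF assms])

text \<open>Lagrange's identity for \<open>f\<close> and the constant vector 1; for mean zero only
  the sum of squares survives.\<close>

lemma sum_pairwise_square_diff:
  fixes f :: "nat \<Rightarrow> real"
  shows "(\<Sum>(s, t)\<in>{(s, t). s < t \<and> t < n}. (f s - f t)\<^sup>2) =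
    real n * (\<Sum>s<n. (f s)\<^sup>2) - (\<Sum>s<n. f s)\<^sup>2"
proof (induction n)
  case (Suc n)
  have eq: "{(s, t). s < t \<and> t < Suc n} = {(s, t). s < t \<and> t < n} \<union> (\<lambda>s. (s, n)) ` {..<n}"
    by (auto simp: less_Suc_eq)
  have fin: "finite {(s, t). s < t \<and> t < n}"
    by (rule finite_subset[of _ "{..<n} \<times> {..<n}"]) auto
  have "(\<Sum>(s, t)\<in>{(s, t). s < t \<and> t < Suc n}. (f s - f t)\<^sup>2) =
      (\<Sum>(s, t)\<in>{(s, t). s < t \<and> t < n}. (f s - f t)\<^sup>2) + (\<Sum>s<n. (f s - f n)\<^sup>2)"
    unfolding eq by (subst sum.union_disjoint) (auto simp: fin sum.reindex inj_on_def)
  also have "(\<Sum>s<n. (f s - f n)\<^sup>2) = (\<Sum>s<n. (f s)\<^sup>2) - 2 * f n * (\<Sum>s<n. f s) + real n * (f n)\<^sup>2"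
    by (simp add: power2_diff sum.distrib sum_subtractf sum_distrib_left algebra_simps)
  finally show ?case
    unfolding Suc.IH by (simp add: power2_sum algebra_simps)
qed simp

text \<open>Subtracting the mean from the unit potential changes neither its voltages nor its
  Laplacian image, but makes the square of the sum vanish in
  \<open>sum_pairwise_square_diff\<close>.\<close>

lemma Delta_kirchhoff_eq:
  assumes sg: "simple_graph n E" and con: "connected_graph n E" and e: "{i, j} \<in> E"
  obtains u :: "real vec" where "u \<in> carrier_vec n"
    and "laplacian n E unit_weight *\<^sub>v u = unit_vec n i - unit_vec n j"
    and "(\<Sum>x<n. u $ x) = 0"
    and "Delta_kirchhoff n E {i, j} a = - a * real n * (\<Sum>x<n. (u $ x)\<^sup>2)"
proof -
  have ij: "i < n" "j < n" "i \<noteq> j" using simple_graph_edge[OF sg e] by auto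
  define p where "p = unit_potential n E i j"
  have p: "p \<in> carrier_vec n" "laplacian n E unit_weight *\<^sub>v p = unit_vec n i - unit_vec n j"
    using laplacian_unit_potential[OF sg con ij(1,2)] by (auto simp: p_def)
  define m where "m = (\<Sum>x<n. p $ x) / real n"
  define u where "u = vec n (\<lambda>x. p $ x - m)"
  have u: "u \<in> carrier_vec n" by (simp add: u_def)
  have "laplacian n E unit_weight *\<^sub>v u = laplacian n E unit_weight *\<^sub>v p"
  proof (rule eq_vecI)
    fix x assume "x < dim_vec (laplacian n E unit_weight *\<^sub>v p)"
    then have x: "x < n" by (simp add: laplacian_dim)
    show "(laplacian n E unit_weight *\<^sub>v u) $ x = (laplacian n E unit_weight *\<^sub>v p) $ x"
      unfolding laplacian_mult_vec[OF u x] laplacian_mult_vec[OF p(1) x]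
      using x by (intro sum.cong) (auto simp: u_def)
  qed auto
  then have Lu: "laplacian n E unit_weight *\<^sub>v u = unit_vec n i - unit_vec n j" using p(2) by simp
  have sum0: "(\<Sum>x<n. u $ x) = 0" using ij by (simp add: u_def sum_subtractf m_def)
  let ?P = "{(s, t). s < t \<and> t < n}"
  have "Delta_kirchhoff n E {i, j} a = (\<Sum>(s, t)\<in>?P. Delta_resistance n E {i, j} a s t)"
    unfolding Delta_kirchhoff_def kirchhoff_index_def Delta_resistance_def
    by (simp add: inf_part_sum case_prod_unfold)
  also have "\<dots> = (\<Sum>(s, t)\<in>?P. - a * (u $ s - u $ t)\<^sup>2)"
    by (rule sum.cong) (auto simp: Delta_resistance_eq[OF sg con e] p_def[symmetric] u_def)
  also have "\<dots> = - a * (\<Sum>(s, t)\<in>?P. (u $ s - u $ t)\<^sup>2)"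
    by (simp add: sum_distrib_left case_prod_unfold)
  also have "\<dots> = - a * real n * (\<Sum>x<n. (u $ x)\<^sup>2)"
    unfolding sum_pairwise_square_diff sum0 by simp
  finally show ?thesis using that u Lu sum0 by blast
qed

section \<open>Diagonalisation of real symmetric matrices\<close>

lemma mult_mat_vec_index_sum:
  fixes A :: "'a::semiring_0 mat"
  assumes "A \<in> carrier_mat m n" "v \<in> carrier_vec n" "i < m"
  shows "(A *\<^sub>v v) $ i = (\<Sum>j<n. A $$ (i, j) * v $ j)"
  using assms by (auto simp: scalar_prod_def lessThan_atLeast0 intro!: sum.cong)

text \<open>The polynomial splits over the complex numbers. Each root is real: the Hermitian form at
  an eigenvector equals the root times a positive norm, and symmetry makes that form invariant under
  conjugation.\<close>

lemma symmetric_real_char_poly_splits: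
  fixes A :: "real mat"
  assumes A: "A \<in> carrier_mat n n" and sym: "transpose_mat A = A"
  shows "\<exists>es. char_poly A = (\<Prod>e\<leftarrow>es. [:- e, 1:])"
proof -
  define C where "C = map_mat complex_of_real A"
  have C: "C \<in> carrier_mat n n" using A by (simp add: C_def)
  obtain as where as: "char_poly C = (\<Prod>a\<leftarrow>as. [:- a, 1:])"
    using char_poly_factorized[OF C] by blast
  have symA: "A $$ (i, j) = A $$ (j, i)" if "i < n" "j < n" for i j
    using arg_cong[OF sym, of "\<lambda>M. M $$ (i, j)"] A that by auto
  have real: "a \<in> \<real>" if "a \<in> set as" for a
  proof -
    have "poly (char_poly C) a = 0" unfolding as using linear_poly_root[OF that] .
    then obtain v where v: "v \<in> carrier_vec n" "v \<noteq> 0\<^sub>v n" "C *\<^sub>v v = a \<cdot>\<^sub>v v"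
      using eigenvalue_root_char_poly[OF C, of a] C by (auto simp: eigenvalue_def eigenvector_def)
    define S where "S = (\<Sum>i<n. \<Sum>j<n. cnj (v $ i) * (complex_of_real (A $$ (i, j)) * v $ j))"
    define N where "N = (\<Sum>i<n. (cmod (v $ i))\<^sup>2)"
    have "(\<Sum>j<n. complex_of_real (A $$ (i, j)) * v $ j) = a * v $ i" if "i < n" for i
    proof -
      have "(C *\<^sub>v v) $ i = (\<Sum>j<n. complex_of_real (A $$ (i, j)) * v $ j)"
        unfolding mult_mat_vec_index_sum[OF C v(1) that]
        using A that by (intro sum.cong) (auto simp: C_def)
      then show ?thesis using v that by simp
    qed
    then have "S = (\<Sum>i<n. cnj (v $ i) * (a * v $ i))"
      unfolding S_def sum_distrib_left[symmetric] by (intro sum.cong) auto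
    also have "\<dots> = a * complex_of_real N"
      unfolding N_def of_real_sum sum_distrib_left
      by (intro sum.cong) (auto simp: complex_norm_square mult.commute mult.left_commute simp del: of_real_power)
    finally have S: "S = a * complex_of_real N" .
    have "cnj S = (\<Sum>i<n. \<Sum>j<n. v $ i * (complex_of_real (A $$ (i, j)) * cnj (v $ j)))"
      by (simp add: S_def)
    also have "\<dots> = (\<Sum>j<n. \<Sum>i<n. v $ i * (complex_of_real (A $$ (i, j)) * cnj (v $ j)))"
      by (rule sum.swap)
    also have "\<dots> = S"
      unfolding S_def by (intro sum.cong refl) (auto simp: symA mult.commute mult.left_commute)
    finally have "S \<in> \<real>" by (simp add: Reals_cnj_iff)
    moreover have "N \<noteq> 0"
    proof
      assume "N = 0"
      then have "v $ i = 0" if "i < n" for i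
        using that by (simp add: N_def sum_nonneg_eq_0_iff)
      then show False using v by auto
    qed
    ultimately have "S / complex_of_real N \<in> \<real>" by simp
    then show ?thesis using S \<open>N \<noteq> 0\<close> by simp
  qed
  define es where "es = map Re as"
  have as_es: "as = map complex_of_real es"
    using real by (simp add: es_def map_idI)
  interpret h: map_poly_comm_ring_hom complex_of_real ..
  have "map_poly complex_of_real (char_poly A) = char_poly C"
    unfolding C_def by (rule of_real_hom.char_poly_hom[OF A, symmetric])
  also have "\<dots> = map_poly complex_of_real (\<Prod>e\<leftarrow>es. [:- e, 1:])"
    unfolding as as_es by (induction es) (simp_all add: h.hom_mult map_poly_pCons o_def del: mult_pCons_left)
  finally have "char_poly A = (\<Prod>e\<leftarrow>es. [:- e, 1:])"
    by (simp add: poly_eq_iff coeff_map_poly)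
  then show ?thesis by blast
qed

text \<open>A Householder reflection; when \<open>v\<close> is already a multiple of the first unit vector the
  coefficient \<open>2 / 0 = 0\<close> makes it the identity.\<close>

lemma reflection_with_first_column:
  fixes v :: "real vec"
  assumes v: "v \<in> carrier_vec n" "v \<noteq> 0\<^sub>v n" and n: "0 < n"
  obtains W k where "W \<in> carrier_mat n n" "transpose_mat W = W" "W * W = 1\<^sub>m n"
    "W *\<^sub>v unit_vec n 0 = k \<cdot>\<^sub>v v"
proof -
  define N where "N = (\<Sum>i<n. (v $ i)\<^sup>2)"
  have "N \<noteq> 0"
  proof
    assume "N = 0"
    then have "v $ i = 0" if "i < n" for i
      using that by (simp add: N_def sum_nonneg_eq_0_iff)
    then show False using v by auto
  qed
  then have N: "N > 0" by (simp add: N_def order.not_eq_order_implies_strict sum_nonneg)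
  define k where "k = 1 / sqrt N"
  have k2: "k\<^sup>2 * N = 1" using N by (simp add: k_def power_divide)
  define y where "y i = k * v $ i" for i
  have y1: "(\<Sum>i<n. (y i)\<^sup>2) = 1"
    using k2 by (simp add: y_def power_mult_distrib N_def sum_distrib_left)
  define \<delta> :: "nat \<Rightarrow> nat \<Rightarrow> real" where "\<delta> i j = of_bool (i = j)" for i j
  have \<delta>_sum: "(\<Sum>m<n. \<delta> i m * f m) = f i" "(\<Sum>m<n. f m * \<delta> m i) = f i" if "i < n" for i f
    using that by (simp_all add: \<delta>_def of_bool_def if_distrib if_distribR cong: if_cong)
  \<comment> \<open>The reflection along \<open>q\<close>, the difference of the unit vectors
    \<open>y\<close> and e_0, exchanges these two vectors.\<close>
  define q where "q i = y i - \<delta> i 0" for i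
  define qq where "qq = (\<Sum>i<n. (q i)\<^sup>2)"
  define c where "c = 2 / qq"
  have qq: "qq = 2 - 2 * y 0"
  proof -
    have "qq = (\<Sum>i<n. (y i)\<^sup>2 - 2 * (y i * \<delta> i 0) + \<delta> 0 i * \<delta> i 0)"
      unfolding qq_def q_def by (intro sum.cong) (auto simp: power2_eq_square \<delta>_def algebra_simps)
    then show ?thesis
      using n y1 by (simp add: sum.distrib sum_subtractf sum_distrib_left[symmetric] \<delta>_sum)
        (simp add: \<delta>_def)
  qed
  \<comment> \<open>This identity makes \<open>W\<close> an involution; for \<open>qq = 0\<close>
    both sides are 0.\<close>
  have cc: "c * c * qq = 2 * c" by (simp add: c_def)
  have q0: "q i = 0" if "qq = 0" "i < n" for i
    using that by (simp add: qq_def sum_nonneg_eq_0_iff)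
  define W where "W = mat n n (\<lambda>(i, j). \<delta> i j - c * q i * q j)"
  have W: "W \<in> carrier_mat n n" by (simp add: W_def)
  moreover have "transpose_mat W = W"
    by (rule eq_matI) (auto simp: W_def \<delta>_def)
  moreover have "W * W = 1\<^sub>m n"
  proof (rule eq_matI)
    fix i j assume "i < dim_row (1\<^sub>m n :: real mat)" "j < dim_col (1\<^sub>m n :: real mat)"
    then have ij: "i < n" "j < n" by auto
    have "(W * W) $$ (i, j) = (\<Sum>m<n. (\<delta> i m - c * q i * q m) * (\<delta> m j - c * q m * q j))"
      using ij by (simp add: W_def scalar_prod_def lessThan_atLeast0)
    also have "\<dots> = (\<Sum>m<n. \<delta> i m * (\<delta> m j - c * q m * q j)) - c * q i * (\<Sum>m<n. q m * \<delta> m j)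
        + c * c * q i * q j * (\<Sum>m<n. (q m)\<^sup>2)"
      unfolding sum_distrib_left sum_subtractf[symmetric] sum.distrib[symmetric]
      by (intro sum.cong) (auto simp: algebra_simps power2_eq_square)
    also have "\<dots> = \<delta> i j - 2 * c * q i * q j + (c * c * qq) * q i * q j"
      unfolding \<delta>_sum[OF ij(1)] \<delta>_sum[OF ij(2)] qq_def by (simp add: algebra_simps)
    also have "\<dots> = \<delta> i j" unfolding cc by simp
    finally show "(W * W) $$ (i, j) = 1\<^sub>m n $$ (i, j)"
      using ij by (simp add: \<delta>_def)
  qed (use W in auto)
  moreover have "W *\<^sub>v unit_vec n 0 = k \<cdot>\<^sub>v v"
  proof (rule eq_vecI)
    fix i assume "i < dim_vec (k \<cdot>\<^sub>v v)"
    then have i: "i < n" using v by simp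
    have "(W *\<^sub>v unit_vec n 0) $ i = \<delta> i 0 - c * q i * q 0"
      using i n W by (simp add: W_def)
    also have "\<dots> = \<delta> i 0 + q i"
    proof (cases "qq = 0")
      case False
      \<comment> \<open>Hence \<open>c * q 0 = -1\<close>, and e_0 is sent to e_0 +
        \<open>q\<close>, which is \<open>y\<close>.\<close>
      have "q 0 = - qq / 2" using qq by (simp add: q_def \<delta>_def)
      then show ?thesis using False by (simp add: c_def)
    qed (use q0 i in simp)
    finally show "(W *\<^sub>v unit_vec n 0) $ i = (k \<cdot>\<^sub>v v) $ i"
      using i v by (simp add: q_def y_def)
  qed (use W v in auto)
  ultimately show ?thesis by (rule that)
qed

lemma mult_block_diag:
  assumes "X \<in> carrier_mat p p" "X' \<in> carrier_mat p p" "Y \<in> carrier_mat q q" "Y' \<in> carrier_mat q q"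
  shows "four_block_mat X (0\<^sub>m p q) (0\<^sub>m q p) Y * four_block_mat X' (0\<^sub>m p q) (0\<^sub>m q p) Y' =
    four_block_mat (X * X') (0\<^sub>m p q) (0\<^sub>m q p) (Y * Y')"
  using assms by (subst mult_four_block_mat[of _ p p _ q _ q]) auto

text \<open>Deflation: a reflection moves an eigenvector for the first root onto the first axis, and
  the remaining block is symmetric with the remaining roots. The diagonal follows the given order of
  \<open>es\<close>, so a sorted list of roots can be supplied.\<close>

theorem symmetric_real_diagonalization:
  fixes A :: "real mat"
  assumes "A \<in> carrier_mat n n" and "transpose_mat A = A"
    and "char_poly A = (\<Prod>e\<leftarrow>es. [:- e, 1:])"
  shows "\<exists>U\<in>carrier_mat n n. transpose_mat U * U = 1\<^sub>m n \<and> A * U = U * mat_diag n (\<lambda>k. es ! k)"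
  using assms
proof (induction es arbitrary: n A)
  case Nil
  then have "n = 0" using degree_monic_char_poly[of A n] by auto
  then show ?case
    using Nil by (intro bexI[of _ "1\<^sub>m n"]) (auto simp: mat_diag_def intro!: eq_matI)
next
  case (Cons e es)
  note A = Cons.prems(1)
  have "degree (char_poly A) = length (e # es)"
    unfolding Cons.prems(3) by (rule degree_linear_factors)
  then obtain m where n: "n = Suc m" and m: "m = length es"
    using degree_monic_char_poly[OF A] by auto
  have "poly (char_poly A) e = 0" unfolding Cons.prems(3) by simp
  then obtain v where v: "v \<in> carrier_vec n" "v \<noteq> 0\<^sub>v n" "A *\<^sub>v v = e \<cdot>\<^sub>v v"
    using eigenvalue_root_char_poly[OF A, of e] A by (auto simp: eigenvalue_def eigenvector_def)
  obtain W k where W: "W \<in> carrier_mat n n" "transpose_mat W = W" "W * W = 1\<^sub>m n"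
    and Wv: "W *\<^sub>v unit_vec n 0 = k \<cdot>\<^sub>v v"
    using reflection_with_first_column[OF v(1,2)] n by auto
  define B where "B = W * (A * W)"
  have B: "B \<in> carrier_mat n n" using A W by (simp add: B_def)
  have WB: "W * B = A * W"
    unfolding B_def using A W by (simp add: assoc_mult_mat[symmetric, of W n n W n "A * W" n])
  have symB: "transpose_mat B = B"
    using A W Cons.prems(2) by (simp add: B_def transpose_mult[of _ n n _ n])
  have B_sym: "B $$ (i, j) = B $$ (j, i)" if "i < n" "j < n" for i j
    using arg_cong[OF symB, of "\<lambda>M. M $$ (i, j)"] B that by auto
  have "B *\<^sub>v unit_vec n 0 = W *\<^sub>v (A *\<^sub>v (k \<cdot>\<^sub>v v))"
    using A W by (simp add: B_def Wv assoc_mult_mat_vec[of _ n n _ n])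
  also have "\<dots> = e \<cdot>\<^sub>v (W *\<^sub>v (W *\<^sub>v unit_vec n 0))"
    using A W v by (simp add: Wv mult_mat_vec[of _ n n] smult_smult_assoc mult.commute)
  also have "\<dots> = e \<cdot>\<^sub>v unit_vec n 0"
    using W by (simp add: assoc_mult_mat_vec[symmetric, of W n n W n])
  finally have B_e: "B *\<^sub>v unit_vec n 0 = e \<cdot>\<^sub>v unit_vec n 0" .
  have B0: "B $$ (i, 0) = (if i = 0 then e else 0)" if "i < n" for i
    using arg_cong[OF B_e, of "\<lambda>w. w $ i"] B that n by auto
  define R where "R = mat m m (\<lambda>(i, j). B $$ (Suc i, Suc j))"
  have R: "R \<in> carrier_mat m m" by (simp add: R_def)
  let ?E = "mat 1 1 (\<lambda>_. e)"
  let ?blk = "\<lambda>X Y. four_block_mat X (0\<^sub>m 1 m) (0\<^sub>m m 1) Y"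
  \<comment> \<open>The first column of \<open>B\<close> is \<open>e\<close> times e_0, and symmetry
    clears the first row too.\<close>
  have B_blk: "B = ?blk ?E R"
  proof (rule eq_matI)
    fix i j assume "i < dim_row (?blk ?E R)" "j < dim_col (?blk ?E R)"
    then have ij: "i < n" "j < n" using R n by auto
    show "B $$ (i, j) = ?blk ?E R $$ (i, j)"
      using ij R n B0[of i] B0[of j] B_sym[of 0 j]
      by (cases i; cases j) (auto simp: R_def)
  qed (use B R n in auto)
  \<comment> \<open>\<open>W\<close> is its own inverse, so \<open>A\<close> and \<open>B\<close>
    have the same characteristic polynomial; cancelling the factor for \<open>e\<close> leaves that
    of \<open>R\<close>.\<close>
  have "similar_mat_wit A B W W"
  proof (rule similar_mat_witI)
    have "W * B * W = A * W * W" by (simp only: WB)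
    also have "\<dots> = A" using A W by (simp add: assoc_mult_mat[of A n n W n W n])
    finally show "A = W * B * W" ..
  qed (use A B W in auto)
  then have "char_poly A = char_poly B"
    by (intro char_poly_similar) (auto simp: similar_mat_def)
  also have "\<dots> = char_poly ?E * char_poly R"
    unfolding B_blk by (rule char_poly_four_block_zeros_col) (use R in auto)
  also have "char_poly ?E = [:- e, 1:]"
    by (simp add: char_poly_defs det_def sign_def)
  finally have "char_poly R = (\<Prod>e\<leftarrow>es. [:- e, 1:])"
    unfolding Cons.prems(3) list.map prod_list.Cons by (metis mult_cancel_left pCons_eq_0_iff zero_neq_one)
  moreover have "transpose_mat R = R"
    using n by (intro eq_matI) (auto simp: R_def B_sym)
  ultimately obtain V where V: "V \<in> carrier_mat m m" "transpose_mat V * V = 1\<^sub>m m"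
    and RV: "R * V = V * mat_diag m (\<lambda>k. es ! k)"
    using Cons.IH[OF R] by blast
  \<comment> \<open>\<open>K\<close> extends \<open>V\<close> by the identity on the first axis;
    \<open>W * K\<close> will diagonalise \<open>A\<close>.\<close>
  define K where "K = ?blk (1\<^sub>m 1) V"
  have K: "K \<in> carrier_mat n n"
    unfolding K_def n using four_block_carrier_mat[OF one_carrier_mat[of 1] V(1)] by simp
  have diag: "mat_diag n (\<lambda>k. (e # es) ! k) = ?blk ?E (mat_diag m (\<lambda>k. es ! k))"
    unfolding n by (rule eq_matI) (auto simp: mat_diag_def nth_Cons' less_Suc_eq_0_disj)
  have "transpose_mat K = ?blk (1\<^sub>m 1) (transpose_mat V)"
    unfolding K_def using transpose_four_block_mat[OF one_carrier_mat zero_carrier_mat zero_carrier_mat V(1)]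
    by (simp only: transpose_one zero_transpose_mat)
  then have KK: "transpose_mat K * K = 1\<^sub>m n"
    unfolding K_def using mult_block_diag[OF one_carrier_mat one_carrier_mat transpose_carrier_mat[THEN iffD2, OF V(1)] V(1)]
    by (simp only: V(2) n four_block_one_mat left_mult_one_mat[OF one_carrier_mat] plus_1_eq_Suc)
  have E: "?E \<in> carrier_mat 1 1" by simp
  have BK: "B * K = K * mat_diag n (\<lambda>k. (e # es) ! k)"
    unfolding K_def B_blk diag mult_block_diag[OF E one_carrier_mat R V(1)]
      mult_block_diag[OF one_carrier_mat E V(1) mat_diag_dim] RV
      left_mult_one_mat[OF E] right_mult_one_mat[OF E] ..
  let ?U = "W * K" and ?D = "mat_diag n (\<lambda>k. (e # es) ! k)"
  have "transpose_mat ?U * ?U = transpose_mat K * (W * (W * K))"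
    using W K by (simp add: transpose_mult[of W n n K n] assoc_mult_mat[of _ n n _ n _ n])
  also have "W * (W * K) = K"
    using W K by (simp add: assoc_mult_mat[symmetric, of W n n W n K n])
  finally have "transpose_mat ?U * ?U = 1\<^sub>m n" using KK by simp
  moreover have "A * ?U = ?U * ?D"
  proof -
    have "A * (W * K) = (A * W) * K" using A W K by (simp add: assoc_mult_mat[of A n n W n K n])
    also have "\<dots> = W * (B * K)" unfolding WB[symmetric] using W(1) B K by (rule assoc_mult_mat)
    also have "\<dots> = (W * K) * ?D"
      unfolding BK using W K by (simp add: assoc_mult_mat[of W n n K n ?D n])
    finally show ?thesis .
  qed
  ultimately show ?case using W K by (intro bexI[of _ ?U]) auto
qed

text \<open>The vectors are the columns of the diagonalising matrix. Its transpose is a two-sided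
  inverse, which yields both orthonormality and Parseval's identity.\<close>

theorem symmetric_real_eigenbasis:
  fixes A :: "real mat"
  assumes A: "A \<in> carrier_mat n n" and sym: "transpose_mat A = A"
    and cp: "char_poly A = (\<Prod>e\<leftarrow>es. [:- e, 1:])"
  obtains p where "\<And>k. k < n \<Longrightarrow> p k \<in> carrier_vec n"
    and "\<And>k. k < n \<Longrightarrow> A *\<^sub>v p k = es ! k \<cdot>\<^sub>v p k"
    and "\<And>k l. k < n \<Longrightarrow> l < n \<Longrightarrow> p k \<bullet> p l = of_bool (k = l)"
    and "\<And>u. u \<in> carrier_vec n \<Longrightarrow> u \<bullet> u = (\<Sum>k<n. (p k \<bullet> u)\<^sup>2)"
    and "\<And>k u. k < n \<Longrightarrow> u \<in> carrier_vec n \<Longrightarrow> p k \<bullet> (A *\<^sub>v u) = es ! k * (p k \<bullet> u)"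
proof -
  let ?D = "mat_diag n (\<lambda>k. es ! k)"
  obtain U where U: "U \<in> carrier_mat n n" "transpose_mat U * U = 1\<^sub>m n" and AU: "A * U = U * ?D"
    using symmetric_real_diagonalization[OF assms] by blast
  let ?V = "transpose_mat U"
  have V: "?V \<in> carrier_mat n n" using U by simp
  have UV: "U * ?V = 1\<^sub>m n" using mat_mult_left_right_inverse[OF V U(1) U(2)] .
  define p where "p k = col U k" for k
  have p: "p k \<in> carrier_vec n" if "k < n" for k
    using U that by (simp add: p_def)
  have Ap: "A *\<^sub>v p k = es ! k \<cdot>\<^sub>v p k" if k: "k < n" for k
  proof -
    have "A *\<^sub>v p k = col (A * U) k" unfolding p_def using col_mult2[OF A U(1) k] ..
    also have "\<dots> = es ! k \<cdot>\<^sub>v p k"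
      unfolding AU mat_diag_mult_right[OF U(1)] using U k by (intro eq_vecI) (auto simp: p_def)
    finally show ?thesis .
  qed
  have orth: "p k \<bullet> p l = of_bool (k = l)" if "k < n" "l < n" for k l
    using arg_cong[OF U(2), of "\<lambda>M. M $$ (k, l)"] U(1) that by (simp add: p_def)
  have Vu: "(?V *\<^sub>v u) $ k = p k \<bullet> u" if "k < n" for k u
    using U that by (simp add: p_def)
  have parseval: "u \<bullet> u = (\<Sum>k<n. (p k \<bullet> u)\<^sup>2)" if u: "u \<in> carrier_vec n" for u
  proof -
    have Vu_c: "?V *\<^sub>v u \<in> carrier_vec n" using mult_mat_vec_carrier[OF V u] .
    have "(?V *\<^sub>v u) \<bullet> (?V *\<^sub>v u) = u \<bullet> (U *\<^sub>v (?V *\<^sub>v u))"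
      by (rule transpose_vec_mult_scalar[OF U(1) Vu_c u])
    also have "U *\<^sub>v (?V *\<^sub>v u) = u"
      unfolding assoc_mult_mat_vec[OF U(1) V u, symmetric] UV using u by simp
    finally have "u \<bullet> u = (\<Sum>k<n. (?V *\<^sub>v u) $ k * (?V *\<^sub>v u) $ k)"
      using Vu_c by (simp only: scalar_prod_def lessThan_atLeast0 carrier_vecD)
    then show ?thesis by (simp add: Vu power2_eq_square)
  qed
  have adj: "p k \<bullet> (A *\<^sub>v u) = es ! k * (p k \<bullet> u)" if k: "k < n" and u: "u \<in> carrier_vec n" for k u
  proof -
    have "p k \<bullet> (A *\<^sub>v u) = (transpose_mat A *\<^sub>v p k) \<bullet> u"
      by (rule transpose_vec_mult_scalar[OF A u p[OF k], symmetric])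
    then show ?thesis unfolding sym Ap[OF k] using p[OF k] u by simp
  qed
  show ?thesis by (rule that[OF p Ap orth parseval adj])
qed

section \<open>Laplacian spectrum\<close>

definition laplacian_spectrum :: "nat \<Rightarrow> nat set set \<Rightarrow> real list" where
  "laplacian_spectrum n E =
     rev (sorted_list_of_multiset (proots (char_poly (laplacian n E unit_weight))))"

lemma laplacian_eigenvalue_nth: "laplacian_eigenvalue n E k = laplacian_spectrum n E ! (k - 1)"
  by (simp add: laplacian_eigenvalue_def laplacian_spectrum_def)

lemma transpose_laplacian: "transpose_mat (laplacian n E w) = laplacian n E w"
  by (rule eq_matI)
    (auto simp: laplacian_dim laplacian_def degree_matrix_def adjacency_matrix_def insert_commute)

text \<open>As the polynomial splits over the reals, sorting its roots only permutes the linear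
  factors, so the spectrum list loses no eigenvalue.\<close>

lemma char_poly_laplacian:
  "char_poly (laplacian n E unit_weight) = (\<Prod>e\<leftarrow>laplacian_spectrum n E. [:- e, 1:])"
proof -
  obtain es where es: "char_poly (laplacian n E unit_weight) = (\<Prod>e\<leftarrow>es. [:- e, 1:])"
    using symmetric_real_char_poly_splits[OF laplacian_carrier transpose_laplacian] by blast
  have "proots (\<Prod>e\<leftarrow>es. [:- e, 1:]) = mset es"
    by (induction es) (simp_all add: proots_mult prod_list_zero_iff image_iff del: mult_pCons_left)
  then have "mset (laplacian_spectrum n E) = mset es"
    unfolding laplacian_spectrum_def es by simp
  then have "mset (map (\<lambda>e. [:- e, 1:]) (laplacian_spectrum n E)) = mset (map (\<lambda>e. [:- e, 1:]) es)"
    by simp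
  then show ?thesis unfolding es by (metis prod_mset_prod_list)
qed

lemma length_laplacian_spectrum: "length (laplacian_spectrum n E) = n"
  using degree_monic_char_poly[OF laplacian_carrier, of n E unit_weight]
  unfolding char_poly_laplacian degree_linear_factors by simp

lemma laplacian_spectrum_antimono:
  assumes "k \<le> l" "l < n"
  shows "laplacian_spectrum n E ! l \<le> laplacian_spectrum n E ! k"
  using assms
  by (intro sorted_rev_nth_mono) (simp_all add: length_laplacian_spectrum, simp add: laplacian_spectrum_def)

text \<open>The last eigenvector is constant, so a vector of mean zero has no component along it.\<close>

lemma laplacian_norm_bounds:
  fixes u :: "real vec"
  assumes sg: "simple_graph n E" and con: "connected_graph n E" and n: "2 \<le> n"
    and u: "u \<in> carrier_vec n" and mean: "(\<Sum>x<n. u $ x) = 0"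
  defines "Lu \<equiv> laplacian n E unit_weight *\<^sub>v u"
  shows "0 < laplacian_eigenvalue n E (n - 1)"
    and "laplacian_eigenvalue n E (n - 1) \<le> laplacian_eigenvalue n E 1"
    and "(laplacian_eigenvalue n E (n - 1))\<^sup>2 * (u \<bullet> u) \<le> Lu \<bullet> Lu"
    and "Lu \<bullet> Lu \<le> (laplacian_eigenvalue n E 1)\<^sup>2 * (u \<bullet> u)"
proof -
  let ?L = "laplacian n E unit_weight" and ?d = "\<lambda>k. laplacian_spectrum n E ! k"
  obtain p where p: "\<And>k. k < n \<Longrightarrow> p k \<in> carrier_vec n"
    and Lp: "\<And>k. k < n \<Longrightarrow> ?L *\<^sub>v p k = ?d k \<cdot>\<^sub>v p k"
    and orth: "\<And>k l. k < n \<Longrightarrow> l < n \<Longrightarrow> p k \<bullet> p l = of_bool (k = l)"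
    and parseval: "\<And>u. u \<in> carrier_vec n \<Longrightarrow> u \<bullet> u = (\<Sum>k<n. (p k \<bullet> u)\<^sup>2)"
    and adj: "\<And>k u. k < n \<Longrightarrow> u \<in> carrier_vec n \<Longrightarrow> p k \<bullet> (?L *\<^sub>v u) = ?d k * (p k \<bullet> u)"
  proof (rule symmetric_real_eigenbasis[OF laplacian_carrier transpose_laplacian char_poly_laplacian[of n E]], goal_cases)
    case (1 p)
    from 1(2-6) show ?thesis by (rule 1(1))
  qed
  have dot: "v \<bullet> w = (\<Sum>x<n. v $ x * w $ x)" if "w \<in> carrier_vec n" for v w :: "real vec"
    using that by (simp add: scalar_prod_def lessThan_atLeast0)
  have L_carrier: "?L *\<^sub>v v \<in> carrier_vec n" if "v \<in> carrier_vec n" for v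
    using mult_mat_vec_carrier[OF laplacian_carrier that] .
  have nonneg: "0 \<le> ?d k" if k: "k < n" for k
  proof -
    \<comment> \<open>The eigenvalue is the Rayleigh quotient of a unit eigenvector, hence half of a
      nonnegative Dirichlet form.\<close>
    have "?d k = p k \<bullet> (?L *\<^sub>v p k)" using adj[OF k p[OF k]] orth[OF k k] by simp
    also have "\<dots> = (\<Sum>x<n. p k $ x * (?L *\<^sub>v p k) $ x)"
      by (rule dot[OF L_carrier[OF p[OF k]]])
    also have "2 * \<dots> = (\<Sum>x<n. \<Sum>y<n. if {x, y} \<in> E then (p k $ x - p k $ y) * (p k $ x - p k $ y) else 0)"
      by (rule laplacian_dirichlet_form[OF p[OF k]])
    finally have "2 * ?d k = (\<Sum>x<n. \<Sum>y<n. if {x, y} \<in> E then (p k $ x - p k $ y) * (p k $ x - p k $ y) else 0)"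
      by simp
    also have "\<dots> \<ge> 0" by (intro sum_nonneg) auto
    finally show ?thesis by simp
  qed
  have const: "\<exists>c. \<forall>x<n. p k $ x = c" if k: "k < n" and 0: "?d k = 0" for k
  proof -
    have "?L *\<^sub>v p k = 0\<^sub>v n" unfolding Lp[OF k] 0 using p[OF k] by (intro eq_vecI) auto
    then show ?thesis
      using laplacian_harmonic_const[OF con p[OF k] _ _ _ sg] k by blast
  qed
  have dot_const: "p k \<bullet> w = c * (\<Sum>x<n. w $ x)" if "\<forall>x<n. p k $ x = c" "w \<in> carrier_vec n" for k c w
    using that by (simp add: dot sum_distrib_left)
  define one :: "real vec" where "one = vec n (\<lambda>_. 1)"
  have one: "one \<in> carrier_vec n" by (simp add: one_def)
  have L_one: "?L *\<^sub>v one = 0\<^sub>v n"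
  proof (rule eq_vecI)
    fix x assume "x < dim_vec (0\<^sub>v n :: real vec)"
    then have x: "x < n" by simp
    show "(?L *\<^sub>v one) $ x = 0\<^sub>v n $ x"
      unfolding laplacian_mult_vec[OF one x] using x by (simp add: one_def cong: if_cong)
  qed (simp add: laplacian_dim)
  \<comment> \<open>The all-ones vector lies in the kernel, so an eigenvector not orthogonal to it
    has eigenvalue 0. As the spectrum is nonnegative and decreasing, its last entry is then
    0.\<close>
  have last: "?d (n - 1) = 0"
  proof -
    have "one \<bullet> one = real n" unfolding dot[OF one] by (simp add: one_def)
    then have "(\<Sum>k<n. (p k \<bullet> one)\<^sup>2) \<noteq> 0" using parseval[OF one] n by simp
    then obtain k where "k \<in> {..<n}" "(p k \<bullet> one)\<^sup>2 \<noteq> 0"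
      by (rule sum.not_neutral_contains_not_neutral)
    then have k: "k < n" "p k \<bullet> one \<noteq> 0" by simp_all
    have "?d k * (p k \<bullet> one) = 0"
      unfolding adj[OF k(1) one, symmetric] L_one using p[OF k(1)] by (rule scalar_prod_right_zero)
    then have "?d k = 0" using k by simp
    then show ?thesis
      using laplacian_spectrum_antimono[of k "n - 1" n E] nonneg[of "n - 1"] k n by simp
  qed
  obtain c where c: "\<forall>x<n. p (n - 1) $ x = c" using const[OF _ last] n by auto
  \<comment> \<open>A second zero would give a second constant eigenvector, but two nonzero constant
    vectors are never orthogonal.\<close>
  have "?d (n - 2) \<noteq> 0"
  proof
    assume "?d (n - 2) = 0"
    then obtain c' where c': "\<forall>x<n. p (n - 2) $ x = c'" using const[of "n - 2"] n by auto
    have lt: "n - 1 < n" "n - 2 < n" "n - 1 \<noteq> n - 2" using n by auto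
    have sums: "(\<Sum>x<n. p (n - 1) $ x) = c * real n" "(\<Sum>x<n. p (n - 2) $ x) = c' * real n"
      using c c' by simp_all
    have "c * (c * real n) = 1"
      using dot_const[OF c p[OF lt(1)]] orth[OF lt(1,1)] by (simp only: sums) simp
    moreover have "c' * (c' * real n) = 1"
      using dot_const[OF c' p[OF lt(2)]] orth[OF lt(2,2)] by (simp only: sums) simp
    moreover have "c * (c' * real n) = 0"
      using dot_const[OF c p[OF lt(2)]] orth[OF lt(1,2)] lt(3) by (simp only: sums) simp
    ultimately show False by auto
  qed
  then have pos: "?d (n - 2) > 0" using nonneg[of "n - 2"] n by simp
  \<comment> \<open>Eigenvalues are numbered from 1 and list entries from 0, so number
    \<open>n - 1\<close> sits at index \<open>n - 2\<close>.\<close>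
  have ev: "laplacian_eigenvalue n E 1 = ?d 0" "laplacian_eigenvalue n E (n - 1) = ?d (n - 2)"
    by (simp_all add: laplacian_eigenvalue_nth numeral_2_eq_2)
  show "0 < laplacian_eigenvalue n E (n - 1)" using pos ev by simp
  show "laplacian_eigenvalue n E (n - 1) \<le> laplacian_eigenvalue n E 1"
    unfolding ev using n by (intro laplacian_spectrum_antimono) auto
  have norm_Lu: "Lu \<bullet> Lu = (\<Sum>k<n. (?d k)\<^sup>2 * (p k \<bullet> u)\<^sup>2)"
    unfolding Lu_def parseval[OF L_carrier[OF u]]
    by (intro sum.cong) (auto simp: adj[OF _ u] power_mult_distrib)
  have norm_u: "c * (u \<bullet> u) = (\<Sum>k<n. c * (p k \<bullet> u)\<^sup>2)" for c
    unfolding parseval[OF u] by (rule sum_distrib_left)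
  have pu: "p (n - 1) \<bullet> u = 0" using dot_const[OF c u] mean by simp
  show "(laplacian_eigenvalue n E (n - 1))\<^sup>2 * (u \<bullet> u) \<le> Lu \<bullet> Lu"
    unfolding ev norm_Lu norm_u
  proof (rule sum_mono)
    fix k assume "k \<in> {..<n}"
    then have k: "k < n" by simp
    show "(?d (n - 2))\<^sup>2 * (p k \<bullet> u)\<^sup>2 \<le> (?d k)\<^sup>2 * (p k \<bullet> u)\<^sup>2"
    \<comment> \<open>The component of \<open>u\<close> at the last index vanishes; every other
      index is at most \<open>n - 2\<close>, where the eigenvalues dominate the smallest positive
      one.\<close>
    proof (cases "k = n - 1")
      case True
      then show ?thesis using pu by simp
    next
      case False
      then have "?d (n - 2) \<le> ?d k" using k n by (intro laplacian_spectrum_antimono) auto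
      then show ?thesis using pos by (intro mult_right_mono power_mono) auto
    qed
  qed
  show "Lu \<bullet> Lu \<le> (laplacian_eigenvalue n E 1)\<^sup>2 * (u \<bullet> u)"
    unfolding ev norm_Lu norm_u
    by (intro sum_mono mult_right_mono power_mono laplacian_spectrum_antimono) (auto simp: nonneg)
qed

theorem theorem3p9:
  fixes n i j :: nat and E :: "nat set set" and a :: real
  assumes "simple_graph n E" and "connected_graph n E" and "{i, j} \<in> E"
  shows
    "(Delta_resistance n E {i, j} a i j = - a * (eff_resistance n E unit_weight i j)\<^sup>2 \<and>
      - a * (eff_resistance n E unit_weight i j)\<^sup>2 =
        - (a / (real (num_spanning_trees n E))\<^sup>2)
          * (real (num_spanning_trees_containing n E {i, j}))\<^sup>2) \<and>
     (a \<noteq> 0 \<longrightarrow>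
        1 / (laplacian_eigenvalue n E 1)\<^sup>2
          \<le> Delta_kirchhoff n E {i, j} a / (- 2 * real n * a) \<and>
        Delta_kirchhoff n E {i, j} a / (- 2 * real n * a)
          \<le> 1 / (laplacian_eigenvalue n E (n - 1))\<^sup>2)"
proof (intro conjI impI)
  have ij: "i < n" "j < n" "i \<noteq> j" using simple_graph_edge[OF assms(1,3)] by auto
  then have n: "2 \<le> n" by auto
  \<comment> \<open>For the pair \<open>i\<close>, \<open>j\<close> itself, the squared voltage is
    the squared resistance.\<close>
  show "Delta_resistance n E {i, j} a i j = - a * (eff_resistance n E unit_weight i j)\<^sup>2"
    by (simp add: Delta_resistance_eq[OF assms ij(1,2)]
        eff_resistance_unit_weight[OF assms(1,2) ij(1,2)])
  show "- a * (eff_resistance n E unit_weight i j)\<^sup>2 =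
      - (a / (real (num_spanning_trees n E))\<^sup>2) * (real (num_spanning_trees_containing n E {i, j}))\<^sup>2"
    by (simp add: eff_resistance_edge[OF assms] power_divide)
  assume a: "a \<noteq> 0"
  obtain u :: "real vec" where u: "u \<in> carrier_vec n" and mean: "(\<Sum>x<n. u $ x) = 0"
    and Lu: "laplacian n E unit_weight *\<^sub>v u = unit_vec n i - unit_vec n j"
    and Kf: "Delta_kirchhoff n E {i, j} a = - a * real n * (\<Sum>x<n. (u $ x)\<^sup>2)"
    using Delta_kirchhoff_eq[OF assms] by metis
  have "u \<bullet> u = (\<Sum>x<n. (u $ x)\<^sup>2)"
    using u by (simp add: scalar_prod_def lessThan_atLeast0 power2_eq_square)
  then have ratio: "Delta_kirchhoff n E {i, j} a / (- 2 * real n * a) = (u \<bullet> u) / 2"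
    using a n Kf by simp
  have two: "(unit_vec n i - unit_vec n j) \<bullet> (unit_vec n i - unit_vec n j :: real vec) = 2"
    using ij by (simp add: minus_scalar_prod_distrib[of _ n] scalar_prod_minus_distrib[of _ n])
  \<comment> \<open>Since the source vector has squared norm 2, the bounds enclose 2 between
    \<open>u \<bullet> u\<close> times the two squared eigenvalues; dividing gives the claim for
    half of \<open>u \<bullet> u\<close>.\<close>
  note bounds = laplacian_norm_bounds[OF assms(1,2) n u mean, unfolded Lu two]
  have "0 < (laplacian_eigenvalue n E 1)\<^sup>2" "0 < (laplacian_eigenvalue n E (n - 1))\<^sup>2"
    using bounds(1,2) by auto
  then show "1 / (laplacian_eigenvalue n E 1)\<^sup>2 \<le> Delta_kirchhoff n E {i, j} a / (- 2 * real n * a)"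
    and "Delta_kirchhoff n E {i, j} a / (- 2 * real n * a) \<le> 1 / (laplacian_eigenvalue n E (n - 1))\<^sup>2"
    unfolding ratio using bounds(3,4) by (simp_all add: field_simps)
qed

end
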